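(* Let $\mathcal H$ and $\mathcal K$ be Hilbert spaces and let $A_1,A_2\in L(\mathcal H,\mathcal K)\setminus\{0\}$ have closed ranges such that $\operatorname{ind}(A_1)=\operatorname{ind}(A_2)$ and $$\Delta(R(A_1),R(A_2))=0\qquad\text{or}\qquad\Delta(N(A_1),N(A_2))=0.$$ If $A_j=Q_j|A_j|$ is the polar decomposition of $A_j$ and $\sigma_j=\sigma_{A_j}$, $j=1,2$, then $$\|Q_1-Q_2\|\le\frac{4}{\sigma_1+\sigma_2}\,\|A_1-A_2\|.$$
   Context: All Hilbert spaces are complex and may be infinite-dimensional. $L(\mathcal H,\mathcal K)$ is the set of bounded linear operators from $\mathcal H$ to $\mathcal K$, and $\|\cdot\|$ is the operator norm. $R(A)$ and $N(A)$ denote the range and kernel of $A$. The symbol $\dim$ always means Hilbert space dimension (a finite or infinite cardinal). The index of $A\in L(\mathcal H,\mathcal K)$ is $\operatorname{ind}(A):=\dim N(A)-\dim R(A)^\perp$, where subtraction of cardinals is defined as follows: $\kappa-\mu$ is the usual integer difference if both are finite; otherwise $\kappa-\mu:=0$ if $\kappa=\mu$, $\kappa-\mu:=\kappa$ if $\kappa>\mu$, and $\kappa-\mu:=-\mu$ (a formal negative of the cardinal $\mu$) if $\kappa<\mu$. For a closed subspace $M$, $P_M$ is the orthogonal projection onto $M$. For closed subspaces $V,W$ of a Hilbert space, the gap from $V$ to $W$ is $\delta(V,W):=\sup\{\|v-P_Wv\|: v\in V,\ \|v\|=1\}=\|(I-P_W)|V\|$, the norm of the restriction of $I-P_W$ to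 $V$ (equal to $0$ if $V=\{0\}$), and the gap difference is $\Delta(V,W):=|\delta(V,W)-\delta(W,V)|$. The polar decomposition of $A$ is the unique representation $A=Q|A|$ with $|A|=(A^*A)^{1/2}$ and $Q\in L(\mathcal H,\mathcal K)$ a partial isometry (isometric on $N(Q)^\perp$) with $N(Q)=N(A)$. For $A\ne0$ with closed range, $\sigma_A:=\inf(\sigma(|A|)\setminus\{0\})$, where $\sigma(|A|)$ is the spectrum of $|A|$; it is known that $\sigma_A>0$ and $\sigma_A=\|(A|N(A)^\perp)^{-1}\|^{-1}$, where $A|N(A)^\perp$ is considered as an operator from $N(A)^\perp$ to $R(A)$. *)

theory Defs
  imports "HOL-Analysis.Analysis" "HOL-Library.Equipollence"
begin

text \<open>
  A complex Hilbert space is a complete real inner product space with a compatible complex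
  structure: \<open>cinner\<close> is sesquilinear (conjugate-linear in the first argument) with real part
  \<open>inner\<close>. Hence \<open>cinner x x\<close> is the square of \<open>norm x\<close>; positive definiteness is inherited from
  \<^class>\<open>real_inner\<close>.
\<close>

class complex_hilbert = real_inner + banach +
  fixes scaleC :: "complex \<Rightarrow> 'a \<Rightarrow> 'a" (infixr "*\<^sub>C" 75)
    and cinner :: "'a \<Rightarrow> 'a \<Rightarrow> complex"
  assumes scaleC_add_right: "a *\<^sub>C (x + y) = a *\<^sub>C x + a *\<^sub>C y"
    and scaleC_add_left: "(a + b) *\<^sub>C x = a *\<^sub>C x + b *\<^sub>C x"
    and scaleC_scaleC: "a *\<^sub>C (b *\<^sub>C x) = (a * b) *\<^sub>C x"
    and scaleC_of_real: "complex_of_real r *\<^sub>C x = r *\<^sub>R x"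
    and cinner_commute: "cinner x y = cnj (cinner y x)"
    and cinner_add_right: "cinner x (y + z) = cinner x y + cinner x z"
    and cinner_scaleC_right: "cinner x (a *\<^sub>C y) = a * cinner x y"
    and Re_cinner: "Re (cinner x y) = inner x y"

definition ocomp :: "'a::complex_hilbert set \<Rightarrow> 'a set" where
  "ocomp M = {x. \<forall>y\<in>M. cinner y x = 0}"

text \<open>
  The bounded complex-linear operators are the bounded real-linear operators \<open>'a \<Rightarrow>\<^sub>L 'b\<close>
  satisfying \<open>clinear_op\<close>. The norm of \<open>'a \<Rightarrow>\<^sub>L 'b\<close> is the operator norm.
\<close>

definition clinear_op :: "('a::complex_hilbert \<Rightarrow>\<^sub>L 'b::complex_hilbert) \<Rightarrow> bool" where
  "clinear_op A \<longleftrightarrow> (\<forall>c x. A (c *\<^sub>C x) = c *\<^sub>C A x)"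

definition null_space :: "('a::complex_hilbert \<Rightarrow>\<^sub>L 'b::complex_hilbert) \<Rightarrow> 'a set" where
  "null_space A = {x. A x = 0}"

definition adj :: "('a::complex_hilbert \<Rightarrow>\<^sub>L 'b::complex_hilbert) \<Rightarrow> ('b \<Rightarrow>\<^sub>L 'a)" where
  "adj A = (THE B :: 'b \<Rightarrow>\<^sub>L 'a. \<forall>x y. cinner (A x) y = cinner x (B y))"

definition positive_op :: "('a::complex_hilbert \<Rightarrow>\<^sub>L 'a) \<Rightarrow> bool" where
  "positive_op T \<longleftrightarrow> clinear_op T \<and> (\<forall>x. cinner x (T x) \<in> \<real>\<^sub>\<ge>\<^sub>0)"

definition op_sqrt :: "('a::complex_hilbert \<Rightarrow>\<^sub>L 'a) \<Rightarrow> ('a \<Rightarrow>\<^sub>L 'a)" where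
  "op_sqrt T = (THE S. positive_op S \<and> S o\<^sub>L S = T)"

definition op_abs :: "('a::complex_hilbert \<Rightarrow>\<^sub>L 'b::complex_hilbert) \<Rightarrow> ('a \<Rightarrow>\<^sub>L 'a)" where
  "op_abs A = op_sqrt (adj A o\<^sub>L A)"

definition partial_isometry :: "('a::complex_hilbert \<Rightarrow>\<^sub>L 'b::complex_hilbert) \<Rightarrow> bool" where
  "partial_isometry Q \<longleftrightarrow> clinear_op Q \<and> (\<forall>x\<in>ocomp (null_space Q). norm (Q x) = norm x)"

definition polar_decomposition ::
    "('a::complex_hilbert \<Rightarrow>\<^sub>L 'b::complex_hilbert) \<Rightarrow> ('a \<Rightarrow>\<^sub>L 'b) \<Rightarrow> bool" where
  "polar_decomposition A Q \<longleftrightarrow>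
     A = Q o\<^sub>L op_abs A \<and> partial_isometry Q \<and> null_space Q = null_space A"

definition spectrum :: "('a::complex_hilbert \<Rightarrow>\<^sub>L 'a) \<Rightarrow> complex set" where
  "spectrum T = {z. \<not> (\<exists>S :: 'a \<Rightarrow>\<^sub>L 'a. clinear_op S \<and>
      (\<forall>x. S (T x - z *\<^sub>C x) = x) \<and> (\<forall>x. T (S x) - z *\<^sub>C S x = x))}"

text \<open>The spectrum of \<open>|A|\<close> is real; \<open>Re\<close> only converts its elements to type \<^typ>\<open>real\<close>.\<close>

definition sigma_op :: "('a::complex_hilbert \<Rightarrow>\<^sub>L 'b::complex_hilbert) \<Rightarrow> real" where
  "sigma_op A = Inf (Re ` (spectrum (op_abs A) - {0}))"

definition proj :: "'a::complex_hilbert set \<Rightarrow> 'a \<Rightarrow> 'a" where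
  "proj M x = (THE y. y \<in> M \<and> x - y \<in> ocomp M)"

text \<open>The case distinction is needed because \<open>Sup {}\<close> is unspecified on \<^typ>\<open>real\<close>.\<close>

definition gap :: "'a::complex_hilbert set \<Rightarrow> 'a set \<Rightarrow> real" where
  "gap V W = (if V = {0} then 0 else Sup {norm (v - proj W v) |v. v \<in> V \<and> norm v = 1})"

definition gap_diff :: "'a::complex_hilbert set \<Rightarrow> 'a set \<Rightarrow> real" where
  "gap_diff V W = \<bar>gap V W - gap W V\<bar>"

definition orthonormal :: "'a::complex_hilbert set \<Rightarrow> bool" where
  "orthonormal B \<longleftrightarrow> (\<forall>x\<in>B. \<forall>y\<in>B. cinner x y = (if x = y then 1 else 0))"

text \<open>An orthonormal basis of \<open>M\<close> is a maximal orthonormal subset of \<open>M\<close>.\<close>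

definition is_onb :: "'a::complex_hilbert set \<Rightarrow> 'a set \<Rightarrow> bool" where
  "is_onb M B \<longleftrightarrow> B \<subseteq> M \<and> orthonormal B \<and>
     (\<forall>C. B \<subseteq> C \<and> C \<subseteq> M \<and> orthonormal C \<longrightarrow> C = B)"

definition onb :: "'a::complex_hilbert set \<Rightarrow> 'a set" where
  "onb M = (SOME B. is_onb M B)"

text \<open>
  \<open>'c cardinal\<close> is the type of cardinalities of subsets of \<open>'c\<close>. For subspaces of \<open>'a\<close> and
  of \<open>'b\<close> to have their dimensions in one such type, both are taken in
  \<open>('a + 'b) cardinal\<close>, where every subset of \<open>'a\<close> or \<open>'b\<close> has a cardinality.
\<close>

quotient_type 'c cardinal = "'c set" / "eqpoll :: 'c set \<Rightarrow> 'c set \<Rightarrow> bool"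
  morphisms Rep_cardinal cardinal_of
  by (auto intro!: equivpI reflpI sympI transpI intro: eqpoll_sym eqpoll_trans)

lift_definition cardinal_less :: "'c cardinal \<Rightarrow> 'c cardinal \<Rightarrow> bool" is lesspoll
  by (meson eqpoll_sym eq_lesspoll_trans lesspoll_eq_trans)

lift_definition finite_cardinal :: "'c cardinal \<Rightarrow> bool" is finite
  by (rule eqpoll_finite_iff)

lift_definition nat_of_cardinal :: "'c cardinal \<Rightarrow> nat" is card
  by (auto simp: eqpoll_def dest: bij_betw_same_card)

definition dim_dom :: "'a::complex_hilbert set \<Rightarrow> ('a + 'b::complex_hilbert) cardinal" where
  "dim_dom M = cardinal_of (Inl ` onb M)"

definition dim_cod :: "'b::complex_hilbert set \<Rightarrow> ('a::complex_hilbert + 'b) cardinal" where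
  "dim_cod M = cardinal_of (Inr ` onb M)"

text \<open>Values of a difference of cardinals; \<open>NegCard \<mu>\<close> is the formal negative of \<open>\<mu>\<close>.\<close>

datatype 'c cardinal_difference = IntDiff int | PosCard "'c cardinal" | NegCard "'c cardinal"

definition cardinal_diff :: "'c cardinal \<Rightarrow> 'c cardinal \<Rightarrow> 'c cardinal_difference" where
  "cardinal_diff \<kappa> \<mu> =
     (if finite_cardinal \<kappa> \<and> finite_cardinal \<mu>
        then IntDiff (int (nat_of_cardinal \<kappa>) - int (nat_of_cardinal \<mu>))
      else if \<kappa> = \<mu> then IntDiff 0
      else if cardinal_less \<mu> \<kappa> then PosCard \<kappa>
      else NegCard \<mu>)"

definition ind :: "('a::complex_hilbert \<Rightarrow>\<^sub>L 'b::complex_hilbert) \<Rightarrow> ('a + 'b) cardinal_difference"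
  where "ind A = cardinal_diff (dim_dom (null_space A)) (dim_cod (ocomp (range A)))"

end

theory Submission
  imports Defs
begin

text \<open>
  Put \<open>D = A\<^sub>1 - A\<^sub>2\<close>, \<open>X = Q\<^sub>1 - Q\<^sub>2\<close> and \<open>t = 2 \<parallel>D\<parallel> / (\<sigma>\<^sub>1 + \<sigma>\<^sub>2)\<close>, with \<open>\<sigma>\<^sub>1 \<ge> \<sigma>\<^sub>2\<close>. Since
  \<open>|A\<^sub>1\<^sup>*| X + X |A\<^sub>2| = D - Q\<^sub>1 D\<^sup>* Q\<^sub>2\<close>, the compression of \<open>X\<close> to the initial space of \<open>Q\<^sub>2\<close> and the final
  space of \<open>Q\<^sub>1\<close> solves a Sylvester equation whose coefficients are bounded below by \<open>\<sigma>\<^sub>1\<close> and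
  \<open>\<sigma>\<^sub>2\<close>, so its norm is at most \<open>t\<close>. The remaining blocks of \<open>X\<close> are \<open>0\<close> and two blocks whose norms are
  the gaps \<open>\<delta>(N(A\<^sub>2), N(A\<^sub>1))\<close> and \<open>\<delta>(R(A\<^sub>2), R(A\<^sub>1))\<close>. Both \<open>\<delta>(N(A\<^sub>2), N(A\<^sub>1))\<close> and
  \<open>\<delta>(R(A\<^sub>1), R(A\<^sub>2))\<close> are at most \<open>\<parallel>D\<parallel> / \<sigma>\<^sub>1 \<le> t\<close>; if the gap difference of the ranges vanishes, this
  covers all blocks. If the gap difference of the kernels vanishes, the same argument applies
  with the roles of \<open>Q\<^sub>1\<close> and \<open>Q\<^sub>2\<close> exchanged in the block decomposition. A block matrix with one
  zero entry and three entries of norm at most \<open>t\<close> has norm at most \<open>2 t\<close>.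
\<close>

section \<open>Projections and adjoints in Hilbert spaces\<close>

lemma parallelogram:
  fixes x y :: "'a::real_inner"
  shows "(norm (x + y))\<^sup>2 + (norm (x - y))\<^sup>2 = 2 * (norm x)\<^sup>2 + 2 * (norm y)\<^sup>2"
  by (simp add: power2_norm_eq_inner inner_add_left inner_add_right inner_diff_left inner_diff_right inner_commute)

lemma norm_diff_scaleR_sq:
  fixes x z :: "'a::real_inner"
  shows "(norm (x - c *\<^sub>R z))\<^sup>2 = (norm x)\<^sup>2 - 2 * c * inner z x + c\<^sup>2 * (norm z)\<^sup>2"
  by (simp add: power2_norm_eq_inner inner_diff_left inner_diff_right inner_commute)
    (simp add: algebra_simps power2_eq_square)

text \<open>By the parallelogram law a sequence in \<open>S\<close> minimising the distance to
  \<open>x\<close> is Cauchy, since midpoints stay in \<open>S\<close>; minimality of the limit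
  forces orthogonality.\<close>

lemma orthogonal_projection_exists:
  fixes S :: "'a::{real_inner,banach} set"
  assumes S: "subspace S" "closed S"
  shows "\<exists>y\<in>S. \<forall>z\<in>S. inner z (x - y) = 0"
proof -
  define d where "d = (INF y\<in>S. (norm (x - y))\<^sup>2)"
  have bdd: "bdd_below ((\<lambda>y. (norm (x - y))\<^sup>2) ` S)"
    by (rule bdd_belowI[of _ 0]) auto
  have ne: "S \<noteq> {}" using S(1) subspace_0 by auto
  have d_le: "d \<le> (norm (x - y))\<^sup>2" if "y \<in> S" for y
    unfolding d_def by (rule cINF_lower[OF bdd that])
  have "\<exists>y\<in>S. (norm (x - y))\<^sup>2 < d + 1 / real (Suc n)" for n
  proof (rule ccontr)
    assume "\<not> ?thesis"
    then have "d + 1 / real (Suc n) \<le> d"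
      unfolding d_def by (intro cINF_greatest ne) (auto simp: not_less d_def)
    then show False by (simp add: field_simps)
  qed
  then obtain y where y: "y n \<in> S" and yd: "(norm (x - y n))\<^sup>2 < d + 1 / real (Suc n)" for n
    by metis
  have yy: "(norm (y m - y n))\<^sup>2 \<le> 2 * (1 / real (Suc m)) + 2 * (1 / real (Suc n))" for m n
  proof -
    have "(norm ((x - y n) + (x - y m)))\<^sup>2 = 4 * (norm (x - (1/2) *\<^sub>R (y n + y m)))\<^sup>2"
    proof -
      have "(x - y n) + (x - y m) = 2 *\<^sub>R (x - (1/2) *\<^sub>R (y n + y m))"
        by (simp add: algebra_simps scaleR_2)
      then show ?thesis by (simp add: power_mult_distrib)
    qed
    moreover have "d \<le> (norm (x - (1/2) *\<^sub>R (y n + y m)))\<^sup>2"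
      by (intro d_le subspace_scale subspace_add S y)
    moreover have "(x - y n) - (x - y m) = y m - y n" by simp
    ultimately show ?thesis
      using parallelogram[of "x - y n" "x - y m"] yd[of n] yd[of m] by (simp only:)
  qed
  have "Cauchy y"
  proof (rule metric_CauchyI)
    fix e :: real assume e: "e > 0"
    obtain N where N: "4 / e\<^sup>2 < real N" using reals_Archimedean2 by blast
    have "dist (y m) (y n) < e" if "m \<ge> N" "n \<ge> N" for m n
    proof -
      have "2 * (1 / real (Suc k)) < e\<^sup>2 / 2" if "k \<ge> N" for k
      proof -
        have "4 / e\<^sup>2 < real (Suc k)" using N that by linarith
        then show ?thesis using e by (simp add: field_simps)
      qed
      from this[OF that(1)] this[OF that(2)]
      have "(norm (y m - y n))\<^sup>2 < e\<^sup>2" using yy[of m n] by linarith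
      then show ?thesis using e by (simp add: dist_norm power2_less_imp_less)
    qed
    then show "\<exists>M. \<forall>m\<ge>M. \<forall>n\<ge>M. dist (y m) (y n) < e" by blast
  qed
  then obtain p where p: "y \<longlonglongrightarrow> p" using Cauchy_convergent_iff convergent_def by blast
  have pS: "p \<in> S" using closed_sequentially[OF S(2) _ p] y by blast
  have "(norm (x - p))\<^sup>2 \<le> d"
  proof (rule LIMSEQ_le)
    show "(\<lambda>n. (norm (x - y n))\<^sup>2) \<longlonglongrightarrow> (norm (x - p))\<^sup>2"
      by (intro tendsto_intros p)
    show "(\<lambda>n. d + 1 / real (Suc n)) \<longlonglongrightarrow> d"
      using tendsto_add[OF tendsto_const[of d] LIMSEQ_inverse_real_of_nat] by (simp add: inverse_eq_divide)
  qed (use yd less_imp_le in blast)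
  then have min: "(norm (x - p))\<^sup>2 \<le> (norm (x - y))\<^sup>2" if "y \<in> S" for y
    using d_le[OF that] by linarith
  have "inner z (x - p) = 0" if z: "z \<in> S" for z
  proof (cases "z = 0")
    case False
    \<comment> \<open>This \<open>c\<close> minimises the quadratic in
      \<open>norm_diff_scaleR_sq\<close>, so a nonzero inner product would strictly lower the
      distance.\<close>
    define c where "c = inner z (x - p) / (norm z)\<^sup>2"
    have "p + c *\<^sub>R z \<in> S" by (intro subspace_add subspace_scale S z pS)
    from min[OF this] have "(norm (x - p))\<^sup>2 \<le> (norm ((x - p) - c *\<^sub>R z))\<^sup>2" 
      by (simp add: algebra_simps)
    also have "\<dots> = (norm (x - p))\<^sup>2 - 2 * c * inner z (x - p) + c\<^sup>2 * (norm z)\<^sup>2"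
      by (rule norm_diff_scaleR_sq)
    also have "\<dots> = (norm (x - p))\<^sup>2 - (inner z (x - p))\<^sup>2 / (norm z)\<^sup>2"
      using False by (simp add: c_def field_simps power2_eq_square)
    finally show ?thesis using False by (simp add: field_simps)
  qed auto
  with pS show ?thesis by blast
qed

text \<open>For nonzero \<open>f\<close>, the residual \<open>w\<close> of some \<open>u\<close>
  outside the kernel is orthogonal to the kernel, and each \<open>x\<close> differs from an element
  of the kernel by a multiple of \<open>w\<close>.\<close>

lemma riesz_representation:
  fixes f :: "'a::{real_inner,banach} \<Rightarrow> real"
  assumes f: "bounded_linear f"
  shows "\<exists>v. \<forall>x. f x = inner x v"
proof (cases "\<forall>x. f x = 0")
  case True
  then show ?thesis by (intro exI[of _ 0]) auto
next
  case False
  interpret bounded_linear f by fact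
  from False obtain u where u: "f u \<noteq> 0" by blast
  have "subspace {x. f x = 0}"
    by (auto simp: subspace_def add scale zero)
  moreover have "closed {x. f x = 0}"
    by (intro closed_Collect_eq continuous_on_const continuous_on continuous_on_id)
  ultimately obtain p where p: "f p = 0" and orth: "\<And>z. f z = 0 \<Longrightarrow> inner z (u - p) = 0"
    using orthogonal_projection_exists[of "{x. f x = 0}" u] by blast
  define w where "w = u - p"
  have fw: "f w \<noteq> 0" using u p by (simp add: w_def diff)
  then have w0: "inner w w \<noteq> 0" using zero by auto
  have "f x = inner x ((f w / inner w w) *\<^sub>R w)" for x
  proof -
    have "f (x - (f x / f w) *\<^sub>R w) = 0" using fw by (simp add: diff scale)
    from orth[OF this] have "inner x w = f x / f w * inner w w"
      by (simp add: w_def[symmetric] inner_diff_left)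
    then show ?thesis using w0 fw by (simp add: field_simps)
  qed
  then show ?thesis by blast
qed

lemma real_adjoint_exists:
  fixes A :: "'a::{real_inner,banach} \<Rightarrow>\<^sub>L 'b::real_inner"
  shows "\<exists>B::'b \<Rightarrow>\<^sub>L 'a. \<forall>x y. inner (A x) y = inner x (B y)"
proof -
  have "\<exists>v. \<forall>x. inner (A x) y = inner x v" for y
    by (rule riesz_representation)
      (intro bounded_linear_compose[OF bounded_linear_inner_left] blinfun.bounded_linear_right)
  then obtain B where B: "\<And>x y. inner (A x) y = inner x (B y)" by metis
  have "bounded_linear B"
  proof (rule bounded_linear_intro)
    show "B (x + y) = B x + B y" for x y
      by (rule vector_eq_ldot[THEN iffD1]) (simp add: B[symmetric] inner_add_right)
    show "B (r *\<^sub>R x) = r *\<^sub>R B x" for r x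
      by (rule vector_eq_ldot[THEN iffD1]) (simp add: B[symmetric])
    show "norm (B y) \<le> norm y * norm A" for y
    proof (cases "B y = 0")
      case False
      have "(norm (B y))\<^sup>2 = inner (A (B y)) y" by (simp add: B power2_norm_eq_inner)
      also have "\<dots> \<le> norm (A (B y)) * norm y" by (rule norm_cauchy_schwarz)
      also have "\<dots> \<le> (norm A * norm (B y)) * norm y" 
        by (intro mult_right_mono norm_blinfun) auto
      finally have "norm (B y) * norm (B y) \<le> norm (B y) * (norm y * norm A)"
        by (simp add: power2_eq_square algebra_simps)
      then show ?thesis using False by simp
    qed auto
  qed
  then show ?thesis
    by (intro exI[of _ "Blinfun B"]) (simp add: B bounded_linear_Blinfun_apply)
qed

section \<open>Complex structure, adjoints and positivity expressed by the real inner
  product\<close>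

lemma cinner_scaleC_left:
  fixes x y :: "'a::complex_hilbert"
  shows "cinner (c *\<^sub>C x) y = cnj c * cinner x y"
  by (metis cinner_commute cinner_scaleC_right complex_cnj_mult)

lemma Im_cinner:
  fixes x y :: "'a::complex_hilbert"
  shows "Im (cinner x y) = inner (\<i> *\<^sub>C x) y"
  by (simp flip: Re_cinner add: cinner_scaleC_left)

lemma inner_i_scaleC:
  fixes x y :: "'a::complex_hilbert"
  shows "inner (\<i> *\<^sub>C x) y = - inner x (\<i> *\<^sub>C y)"
  by (simp flip: Re_cinner add: cinner_scaleC_left cinner_scaleC_right)

lemma norm_scaleC:
  fixes x :: "'a::complex_hilbert"
  shows "norm (c *\<^sub>C x) = cmod c * norm x"
proof -
  have "(norm (c *\<^sub>C x))\<^sup>2 = Re (cinner (c *\<^sub>C x) (c *\<^sub>C x))"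
    by (simp add: Re_cinner power2_norm_eq_inner)
  also have "\<dots> = Re (complex_of_real ((cmod c)\<^sup>2) * cinner x x)"
    by (simp add: cinner_scaleC_left cinner_scaleC_right complex_norm_square mult.assoc mult.left_commute
        flip: of_real_power)
  also have "\<dots> = (cmod c * norm x)\<^sup>2"
    by (simp add: Re_cinner power2_norm_eq_inner[symmetric] power_mult_distrib flip: of_real_power)
  finally show ?thesis by simp
qed

lemma bounded_linear_scaleC: "bounded_linear (\<lambda>x :: 'a::complex_hilbert. c *\<^sub>C x)"
proof (rule bounded_linear_intro[where K = "cmod c"])
  show "c *\<^sub>C (r *\<^sub>R x) = r *\<^sub>R (c *\<^sub>C x)" for r and x :: 'a
    by (simp add: scaleC_of_real[symmetric] scaleC_scaleC mult.commute)
qed (auto simp: scaleC_add_right norm_scaleC)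

text \<open>The imaginary part of \<open>cinner y x\<close> is
  \<open>inner (\<i> *\<^sub>C y) x\<close>, so closure under \<open>\<i>\<close> lets complex
  orthogonality be tested with the real inner product.\<close>

lemma ocomp_iff_inner:
  assumes "\<And>y. y \<in> M \<Longrightarrow> \<i> *\<^sub>C y \<in> M"
  shows "x \<in> ocomp M \<longleftrightarrow> (\<forall>y\<in>M. inner y x = 0)"
  using assms by (auto simp: ocomp_def complex_eq_iff Re_cinner Im_cinner)

lemma clinear_opD: "clinear_op A \<Longrightarrow> A (c *\<^sub>C x) = c *\<^sub>C A x"
  by (simp add: clinear_op_def)

lemma ocomp_null_space_iff:
  "clinear_op A \<Longrightarrow> x \<in> ocomp (null_space A) \<longleftrightarrow> (\<forall>y. A y = 0 \<longrightarrow> inner y x = 0)"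
  by (subst ocomp_iff_inner)
    (auto simp: null_space_def clinear_opD linear_simps(3)[OF bounded_linear_scaleC])

lemma ocomp_range_iff:
  assumes "clinear_op A"
  shows "x \<in> ocomp (range A) \<longleftrightarrow> (\<forall>y. inner (A y) x = 0)"
  by (subst ocomp_iff_inner) (auto simp flip: clinear_opD[OF assms])

text \<open>\<open>adj\<close> is a definite description, so existence and uniqueness are shown. The
  real adjoint is also the complex one because \<open>A\<close> commutes with
  \<open>\<i>\<close>.\<close>

lemma adj_inner:
  assumes "clinear_op A"
  shows "inner (A x) y = inner x (adj A y)"
proof -
  obtain B where B: "\<And>x y. inner (A x) y = inner x (blinfun_apply B y)"
    using real_adjoint_exists by blast
  have "cinner (A x) y = cinner x (B y)" for x y
    by (simp add: complex_eq_iff Re_cinner Im_cinner B flip: clinear_opD[OF assms])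
  moreover have "B' = B" if "\<And>x y. cinner (A x) y = cinner x (blinfun_apply B' y)" for B'
  proof (rule blinfun_eqI)
    fix y
    have "inner x (B' y) = inner x (B y)" for x
      by (metis B Re_cinner that)
    then show "B' y = B y" by (metis vector_eq_ldot)
  qed
  ultimately have "adj A = B"
    unfolding adj_def by (intro the_equality) auto
  then show ?thesis by (simp add: B)
qed

lemma clinear_adj:
  assumes "clinear_op A"
  shows "clinear_op (adj A)"
proof -
  have "inner x (adj A (c *\<^sub>C y)) = inner x (c *\<^sub>C adj A y)" for c x y
  proof -
    have "inner x (adj A (c *\<^sub>C y)) = Re (c * cinner (A x) y)"
      by (metis adj_inner[OF assms] Re_cinner cinner_scaleC_right)
    also have "cinner (A x) y = cinner x (adj A y)"
      by (simp add: complex_eq_iff Re_cinner Im_cinner adj_inner[OF assms, symmetric]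
          flip: clinear_opD[OF assms])
    finally show ?thesis by (metis Re_cinner cinner_scaleC_right)
  qed
  then show ?thesis unfolding clinear_op_def by (metis vector_eq_ldot)
qed

lemma positive_op_ge_0: "positive_op T \<Longrightarrow> 0 \<le> inner x (T x)"
  by (auto simp: positive_op_def complex_nonneg_Reals_iff Re_cinner[symmetric])

text \<open>Polarisation: realness of \<open>cinner z (T z)\<close> at \<open>x + y\<close> gives
  \<open>eq\<close>, and putting \<open>\<i> *\<^sub>C x\<close> for \<open>x\<close> turns it into
  symmetry.\<close>

lemma positive_op_symmetric:
  assumes T: "positive_op T"
  shows "inner (T x) y = inner x (T y)"
proof -
  note lin = T[unfolded positive_op_def, THEN conjunct1, THEN clinear_opD]
  have Im0: "inner (\<i> *\<^sub>C z) (T z) = 0" for z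
    using T by (auto simp: positive_op_def complex_nonneg_Reals_iff Im_cinner[symmetric])
  have eq: "inner (\<i> *\<^sub>C x) (T y) + inner (\<i> *\<^sub>C y) (T x) = 0" for x y
    using Im0[of "x + y"]
    by (simp add: Im0 scaleC_add_right blinfun.add_right inner_add_left inner_add_right)
  have "inner (\<i> *\<^sub>C \<i> *\<^sub>C x) (T y) = - inner x (T y)"
    using scaleC_of_real[of "-1" x] by (simp add: scaleC_scaleC)
  moreover have "inner (\<i> *\<^sub>C y) (\<i> *\<^sub>C T x) = inner y (T x)"
    using scaleC_of_real[of "-1" "T x"] by (simp add: inner_i_scaleC scaleC_scaleC)
  ultimately show ?thesis
    using eq[of "\<i> *\<^sub>C x" y] by (simp add: lin inner_commute)
qed

lemma positive_opI:
  assumes lin: "clinear_op T" and sym: "\<And>x y. inner (T x) y = inner x (T y)"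
    and nonneg: "\<And>x. 0 \<le> inner x (T x)"
  shows "positive_op T"
proof -
  have "inner (\<i> *\<^sub>C x) (T x) = 0" for x
  proof -
    have "inner (\<i> *\<^sub>C x) (T x) = inner x (\<i> *\<^sub>C T x)"
      using sym[of "\<i> *\<^sub>C x" x] sym[of x "\<i> *\<^sub>C x"] by (simp add: clinear_opD[OF lin] inner_commute)
    then show ?thesis by (simp add: inner_i_scaleC)
  qed
  then show ?thesis
    using lin nonneg by (simp add: positive_op_def complex_nonneg_Reals_iff Re_cinner Im_cinner)
qed

text \<open>Majorisation by the scalar iteration \<open>y \<mapsto> (1 + y\<^sup>2) / 2\<close>, which increases from \<open>0\<close> and
  stays below \<open>1\<close>.\<close>

lemma quadratic_fixed_point_exists:
  fixes B :: "'a::banach \<Rightarrow>\<^sub>L 'a"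
  assumes B: "norm B \<le> 1" and C: "closed C" "0 \<in> C"
    and step: "\<And>Y. Y \<in> C \<Longrightarrow> (1/2) *\<^sub>R (B + (Y o\<^sub>L Y)) \<in> C"
  shows "\<exists>Y\<in>C. norm Y \<le> 1 \<and> Y = (1/2) *\<^sub>R (B + (Y o\<^sub>L Y))"
proof -
  define Y where "Y = rec_nat (0 :: 'a \<Rightarrow>\<^sub>L 'a) (\<lambda>_ Y. (1/2) *\<^sub>R (B + (Y o\<^sub>L Y)))"
  have Y0: "Y 0 = 0" and YS: "Y (Suc n) = (1/2) *\<^sub>R (B + (Y n o\<^sub>L Y n))" for n
    by (simp_all add: Y_def)
  define y where "y = rec_nat (0::real) (\<lambda>_ y. (1 + y\<^sup>2) / 2)"
  have y0: "y 0 = 0" and yS: "y (Suc n) = (1 + (y n)\<^sup>2) / 2" for n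
    by (simp_all add: y_def)
  have YC: "Y n \<in> C" for n
    by (induction n) (auto simp: Y0 YS C step)
  have y01: "0 \<le> y n \<and> y n \<le> 1" for n
    by (induction n) (auto simp: y0 yS power_le_one)
  have Yy: "norm (Y n) \<le> y n" for n
  proof (induction n)
    case (Suc n)
    have "norm (Y n o\<^sub>L Y n) \<le> (y n)\<^sup>2"
      using norm_blinfun_compose[of "Y n" "Y n"] mult_mono[OF Suc Suc] y01[of n]
      by (simp add: power2_eq_square)
    then show ?case
      using norm_triangle_ineq[of B "Y n o\<^sub>L Y n"] B by (simp add: YS yS)
  qed (simp add: Y0 y0)
  have diff: "norm (Y (Suc n) - Y n) \<le> y (Suc n) - y n" for n
  proof (induction n)
    case (Suc n)
    let ?D = "Y (Suc n) - Y n"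
    \<comment> \<open>This splitting of the difference of squares respects the order of the factors,
      so it is valid for noncommuting operators.\<close>
    have "Y (Suc (Suc n)) - Y (Suc n) = (1/2) *\<^sub>R ((Y (Suc n) o\<^sub>L ?D) + (?D o\<^sub>L Y n))"
      by (simp only: YS[of "Suc n"] bounded_bilinear.diff_right[OF bounded_bilinear_blinfun_compose]
          bounded_bilinear.diff_left[OF bounded_bilinear_blinfun_compose])
        (simp add: YS[of n] algebra_simps)
    then have "norm (Y (Suc (Suc n)) - Y (Suc n))
        \<le> (1/2) * (norm (Y (Suc n) o\<^sub>L ?D) + norm (?D o\<^sub>L Y n))"
      using norm_triangle_ineq[of "Y (Suc n) o\<^sub>L ?D" "?D o\<^sub>L Y n"] by simp
    also have "\<dots> \<le> (1/2) * (y (Suc n) * (y (Suc n) - y n) + (y (Suc n) - y n) * y n)"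
      using norm_blinfun_compose[of "Y (Suc n)" ?D] norm_blinfun_compose[of ?D "Y n"]
        mult_mono[OF Yy[of "Suc n"] Suc] mult_mono[OF Suc Yy[of n]] y01[of n] y01[of "Suc n"]
        norm_ge_zero[of ?D] Suc
      by (intro mult_left_mono add_mono) (auto intro: order_trans)
    also have "\<dots> = ((y (Suc n))\<^sup>2 - (y n)\<^sup>2) / 2"
      by (simp add: algebra_simps power2_eq_square)
    also have "\<dots> = y (Suc (Suc n)) - y (Suc n)"
    proof -
      have e: "(y n)\<^sup>2 = 2 * y (Suc n) - 1"
        unfolding yS[of n] by (simp add: add_divide_distrib)
      show ?thesis
        unfolding e yS[of "Suc n"] by (simp add: diff_divide_distrib add_divide_distrib)
    qed
    finally show ?case .
  qed (simp add: Y0 y0 YS yS B)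
  have "incseq y"
  proof (rule incseq_SucI)
    show "y n \<le> y (Suc n)" for n
      using diff[of n] norm_ge_zero[of "Y (Suc n) - Y n"] by linarith
  qed
  then obtain l where "y \<longlonglongrightarrow> l"
    using incseq_convergent[of y 1] y01 by metis
  then have "summable (\<lambda>n. y (Suc n) - y n)"
    by (rule telescope_summable)
  then have "summable (\<lambda>n. Y (Suc n) - Y n)"
    by (rule summable_comparison_test'[where N = 0]) (use diff in auto)
  then have "convergent Y"
    unfolding summable_iff_convergent by (simp add: sum_lessThan_telescope Y0)
  then obtain Z where Z: "Y \<longlonglongrightarrow> Z" by (auto simp: convergent_def)
  have "(\<lambda>n. Y (Suc n)) \<longlonglongrightarrow> (1/2) *\<^sub>R (B + (Z o\<^sub>L Z))"
    unfolding YS by (intro tendsto_intros bounded_bilinear.tendsto[OF bounded_bilinear_blinfun_compose] Z)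
  with LIMSEQ_Suc[OF Z] have "Z = (1/2) *\<^sub>R (B + (Z o\<^sub>L Z))"
    by (rule LIMSEQ_unique)
  moreover have "Z \<in> C" using closed_sequentially[OF C(1) _ Z] YC by blast
  moreover have "norm Z \<le> 1"
    by (rule Lim_bounded[OF tendsto_norm[OF Z]]) (use Yy y01 in \<open>auto intro: order_trans\<close>)
  ultimately show ?thesis by blast
qed

section \<open>Positive operators and square roots\<close>

text \<open>The discriminant argument for the form of \<open>G\<close>. Positivity is asked for on
  \<open>V\<close> only, since it is later applied to \<open>S - \<mu>\<close> on the range of
  \<open>S\<close>.\<close>

lemma psd_cauchy_schwarz:
  fixes G :: "'a::real_inner \<Rightarrow>\<^sub>L 'a"
  assumes V: "subspace V" and psd: "\<And>v. v \<in> V \<Longrightarrow> 0 \<le> inner v (G v)"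
    and sym: "\<And>x y. inner (G x) y = inner x (G y)"
    and x: "x \<in> V" and z: "z \<in> V"
  shows "(inner x (G z))\<^sup>2 \<le> inner x (G x) * inner z (G z)"
proof -
  define a b c where "a = inner x (G x)" "b = inner z (G z)" "c = inner x (G z)"
  have *: "0 \<le> b + 2 * r * c + r\<^sup>2 * a" for r
  proof -
    have "0 \<le> inner (z + r *\<^sub>R x) (G (z + r *\<^sub>R x))"
      by (intro psd subspace_add subspace_scale V x z)
    also have "inner z (G x) = c" by (metis a_b_c_def(3) sym inner_commute)
    then have "inner (z + r *\<^sub>R x) (G (z + r *\<^sub>R x)) = b + 2 * r * c + r\<^sup>2 * a"
      by (simp add: blinfun.add_right blinfun.scaleR_right inner_add_left inner_add_right a_b_c_def)
        (simp add: algebra_simps power2_eq_square)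
    finally show ?thesis .
  qed
  have "a \<ge> 0" by (simp add: a_b_c_def psd x)
  show ?thesis
  proof (cases "a = 0")
    case True
    have "c = 0"
    proof (rule ccontr)
      assume "c \<noteq> 0"
      \<comment> \<open>With \<open>a = 0\<close> the polynomial is affine in \<open>r\<close>, and
        this \<open>r\<close> gives it the value -1.\<close>
      then show False using *[of "- (b + 1) / (2 * c)"] True by (simp add: field_simps)
    qed
    then show ?thesis using True by (simp add: a_b_c_def)
  next
    case False
    with \<open>a \<ge> 0\<close> have "a > 0" by simp
    then show ?thesis using *[of "- c / a"]
      by (simp add: a_b_c_def[symmetric] field_simps power2_eq_square)
  qed
qed

text \<open>Cauchy-Schwarz for the form of \<open>G\<close> at \<open>G x\<close> and
  \<open>x\<close>, with a factor cancelled. It turns smallness of the form into smallness of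
  \<open>G x\<close>.\<close>

lemma psd_norm_sq_le:
  fixes G :: "'a::real_inner \<Rightarrow>\<^sub>L 'a"
  assumes V: "subspace V" and psd: "\<And>v. v \<in> V \<Longrightarrow> 0 \<le> inner v (G v)"
    and sym: "\<And>x y. inner (G x) y = inner x (G y)"
    and x: "x \<in> V" and Gx: "G x \<in> V"
  shows "(norm (G x))\<^sup>2 \<le> norm G * inner x (G x)"
proof (cases "G x = 0")
  case False
  have "((norm (G x))\<^sup>2)\<^sup>2 \<le> inner (G x) (G (G x)) * inner x (G x)"
    using psd_cauchy_schwarz[OF V psd sym Gx x] by (simp add: power2_norm_eq_inner)
  also have "\<dots> \<le> (norm (G x) * (norm G * norm (G x))) * inner x (G x)"
    by (intro mult_right_mono psd x order_trans[OF norm_cauchy_schwarz] mult_left_mono norm_blinfun)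
      auto
  finally have "(norm (G x))\<^sup>2 * (norm (G x))\<^sup>2 \<le> (norm (G x))\<^sup>2 * (norm G * inner x (G x))"
    by (simp add: power2_eq_square ac_simps)
  then show ?thesis by (rule mult_left_le_imp_le) (use False in simp)
qed (use psd[OF x] in auto)

text \<open>The operator norm need not be attained in infinite dimension; such a sequence replaces a
  maximising vector.\<close>

lemma norm_maximizing_sequence:
  fixes T :: "'a::real_normed_vector \<Rightarrow>\<^sub>L 'b::real_normed_vector"
  assumes "T \<noteq> 0"
  shows "\<exists>x. (\<forall>n. norm (x n) = 1) \<and> (\<lambda>n. norm (T (x n))) \<longlonglongrightarrow> norm T"
proof -
  have nT: "norm T > 0" using assms by simp
  have "\<exists>x. norm x = 1 \<and> norm T - 1 / real (Suc n) \<le> norm (T x)" for n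
  proof (rule ccontr)
    assume neg: "\<not> ?thesis"
    \<comment> \<open>Capping by \<open>norm T\<close> keeps \<open>norm T - e\<close> nonnegative,
      as a norm bound must be.\<close>
    define e where "e = min (1 / real (Suc n)) (norm T)"
    have e: "0 < e" "e \<le> norm T" "e \<le> 1 / real (Suc n)" using nT by (auto simp: e_def)
    have "norm T \<le> norm T - e"
    proof (rule norm_blinfun_bound)
      fix x
      show "norm (T x) \<le> (norm T - e) * norm x"
      proof (cases "x = 0")
        case False
        define u where "u = (1 / norm x) *\<^sub>R x"
        have "norm u = 1" using False by (simp add: u_def)
        with neg have "norm (T u) < norm T - 1 / real (Suc n)" by (meson not_le)
        then have "norm (T u) \<le> norm T - e" using e by linarith
        then have "norm (T u) * norm x \<le> (norm T - e) * norm x"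
          by (rule mult_right_mono) auto
        also have "norm (T u) * norm x = norm (T x)"
          using False by (simp add: u_def blinfun.scaleR_right)
        finally show ?thesis .
      qed auto
    qed (use e in auto)
    then show False using e by simp
  qed
  then obtain x where x: "norm (x n) = 1" "norm T - 1 / real (Suc n) \<le> norm (T (x n))" for n
    by metis
  have "(\<lambda>n. norm (T (x n))) \<longlonglongrightarrow> norm T"
  proof (rule tendsto_sandwich)
    show "(\<lambda>n. norm T - 1 / real (Suc n)) \<longlonglongrightarrow> norm T"
      using tendsto_diff[OF tendsto_const LIMSEQ_inverse_real_of_nat, of "norm T"]
      by (simp add: inverse_eq_divide)
    show "\<forall>\<^sub>F n in sequentially. norm (T (x n)) \<le> norm T"
      using norm_blinfun[of T "x _"] by (intro always_eventually allI) (simp add: x(1))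
  qed (use x in auto)
  with x(1) show ?thesis by blast
qed

text \<open>A near-maximiser \<open>x\<close> of \<open>norm (T x)\<close> is nearly an eigenvector of \<open>T\<^sup>*T\<close>.\<close>

lemma near_maximizer_inner:
  fixes T :: "'a::{real_inner,banach} \<Rightarrow>\<^sub>L 'b::real_inner"
  assumes x: "norm x \<le> 1"
  shows "\<bar>(norm T)\<^sup>2 * inner x z - inner (T x) (T z)\<bar>
    \<le> sqrt ((norm T)\<^sup>2 - (norm (T x))\<^sup>2) * (norm T * norm z)"
proof -
  obtain B where B: "\<And>x y. inner (T x) y = inner x (blinfun_apply B y)"
    using real_adjoint_exists by blast
  \<comment> \<open>\<open>G\<close> is positive semidefinite and its form is small at a
    near-maximiser; Cauchy-Schwarz for this form is the estimate.\<close>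
  define G where "G = (norm T)\<^sup>2 *\<^sub>R id_blinfun - (B o\<^sub>L T)"
  have G: "inner y (G z) = (norm T)\<^sup>2 * inner y z - inner (T y) (T z)" for y z
    by (simp add: G_def blinfun.diff_left blinfun.scaleR_left inner_diff_right B)
  have G_sym: "inner (G y) z = inner y (G z)" for y z
    by (metis G inner_commute)
  have psd: "0 \<le> inner y (G y)" for y
    using power_mono[OF norm_blinfun[of T y], of 2]
    by (simp add: G power_mult_distrib flip: power2_norm_eq_inner)
  have "(inner x (G z))\<^sup>2 \<le> inner x (G x) * inner z (G z)"
    by (rule psd_cauchy_schwarz[OF subspace_UNIV psd])
      (simp_all add: G G_sym)
  also have "\<dots> \<le> inner x (G x) * (norm T * norm z)\<^sup>2"
    by (intro mult_left_mono psd) (simp add: G power_mult_distrib power2_norm_eq_inner)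
  finally have "\<bar>inner x (G z)\<bar> \<le> sqrt (inner x (G x) * (norm T * norm z)\<^sup>2)"
    using real_le_rsqrt[of "\<bar>inner x (G z)\<bar>"] by simp
  also have "\<dots> = sqrt (inner x (G x)) * (norm T * norm z)"
    by (simp add: real_sqrt_mult)
  also have "inner x (G x) \<le> (norm T)\<^sup>2 - (norm (T x))\<^sup>2"
    using mult_left_le[of "(norm x)\<^sup>2" "(norm T)\<^sup>2"] power_le_one[OF norm_ge_zero x, of 2]
    by (simp add: G dot_square_norm)
  finally show ?thesis by (simp add: G mult_right_mono)
qed

lemma norm_adj_apply_le:
  assumes "clinear_op A"
  shows "norm (adj A y) \<le> norm A * norm y"
proof (cases "adj A y = 0")
  case False
  have "norm (adj A y) * norm (adj A y) = inner (A (adj A y)) y"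
    by (simp add: adj_inner[OF assms] dot_square_norm power2_eq_square)
  also have "\<dots> \<le> (norm A * norm (adj A y)) * norm y"
    by (intro order_trans[OF norm_cauchy_schwarz] mult_right_mono norm_blinfun) auto
  finally show ?thesis using False by (simp add: mult.commute mult.left_commute)
qed auto

text \<open>After scaling by \<open>c = norm A\<close>, a fixed point \<open>Y\<close> of the
  quadratic iteration satisfies \<open>(1 - Y)\<^sup>2 = 1 - B = T\<close>, so \<open>c\<close>
  times \<open>1 - Y\<close> squares to \<open>adj A o\<^sub>L A\<close>.\<close>

lemma positive_sqrt_exists:
  fixes A :: "'a::complex_hilbert \<Rightarrow>\<^sub>L 'b::complex_hilbert"
  assumes A: "clinear_op A"
  shows "\<exists>S. positive_op S \<and> S o\<^sub>L S = adj A o\<^sub>L A"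
proof (cases "A = 0")
  case True
  have "positive_op (0 :: 'a \<Rightarrow>\<^sub>L 'a)"
    by (rule positive_opI)
      (auto simp: clinear_op_def linear_simps(3)[OF bounded_linear_scaleC])
  with True show ?thesis
    by (intro exI[of _ 0]) (auto intro!: blinfun_eqI)
next
  case False
  define c where "c = norm A"
  have c: "c > 0" using False by (simp add: c_def)
  define T where "T = (1 / c\<^sup>2) *\<^sub>R (adj A o\<^sub>L A)"
  define B where "B = id_blinfun - T"
  have T_inner: "inner x (T y) = inner (A x) (A y) / c\<^sup>2" for x y
    by (simp add: T_def blinfun.scaleR_left adj_inner[OF A])
  have B_inner: "inner (B x) y = inner x (B y)" for x y
    using T_inner[of x y] T_inner[of y x]
    by (simp add: B_def blinfun.diff_left inner_diff_left inner_diff_right inner_commute)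
  have cscale: "(r *\<^sub>R (c' *\<^sub>C x)) = c' *\<^sub>C (r *\<^sub>R x)" for r c' and x :: 'a
    by (simp add: linear_simps(5)[OF bounded_linear_scaleC])
  have cdiff: "c' *\<^sub>C x - c' *\<^sub>C y = c' *\<^sub>C (x - y)" for c' and x y :: 'a
    by (simp add: linear_simps(2)[OF bounded_linear_scaleC])
  have B_lin: "B (c' *\<^sub>C x) = c' *\<^sub>C B x" for c' x
    by (simp add: B_def T_def blinfun.diff_left blinfun.scaleR_left clinear_opD[OF A]
        clinear_opD[OF clinear_adj[OF A]] cscale cdiff)
  have norm_B: "norm B \<le> 1"
  proof (rule norm_blinfun_bound)
    fix x
    have "norm (T x) \<le> c * norm (A x) / c\<^sup>2"
      using norm_adj_apply_le[OF A, of "A x"] c 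
      by (simp add: T_def blinfun.scaleR_left c_def divide_right_mono)
    then have "norm (T x) \<le> norm (A x) / c" using c by (simp add: power2_eq_square)
    then have "(norm (T x))\<^sup>2 \<le> (norm (A x) / c)\<^sup>2" by (rule power_mono) simp
    then have "(norm (T x))\<^sup>2 \<le> (norm (A x))\<^sup>2 / c\<^sup>2" by (simp add: power_divide)
    moreover have "(norm (B x))\<^sup>2 = (norm x)\<^sup>2 - 2 * inner x (T x) + (norm (T x))\<^sup>2"
      using norm_diff_scaleR_sq[of x 1 "T x"] by (simp add: B_def blinfun.diff_left inner_commute)
    moreover have "inner x (T x) = (norm (A x))\<^sup>2 / c\<^sup>2"
      by (simp add: T_inner dot_square_norm)
    moreover have "0 \<le> (norm (A x))\<^sup>2 / c\<^sup>2" by simp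
    ultimately have "(norm (B x))\<^sup>2 \<le> (norm x)\<^sup>2" by linarith
    then show "norm (B x) \<le> 1 * norm x" by (simp add: power2_le_imp_le[OF _ norm_ge_zero])
  qed simp
  \<comment> \<open>A closed set preserved by the iteration: it makes the fixed point complex-linear
    and symmetric.\<close>
  define C where "C = {Y :: 'a \<Rightarrow>\<^sub>L 'a. (\<forall>c x. Y (c *\<^sub>C x) = c *\<^sub>C Y x) \<and>
    (\<forall>x y. inner (Y x) y = inner x (Y y))}"
  have "closed C"
    unfolding C_def
    by (intro closed_Collect_conj closed_Collect_all closed_Collect_eq continuous_intros
        bounded_linear.continuous_on[OF bounded_linear_scaleC])
  moreover have "0 \<in> C"
    by (auto simp: C_def linear_simps(3)[OF bounded_linear_scaleC])
  moreover have "(1/2) *\<^sub>R (B + (Y o\<^sub>L Y)) \<in> C" if "Y \<in> C" for Y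
    using that
    by (auto simp: C_def B_lin blinfun.add_left blinfun.scaleR_left inner_add_left inner_add_right
        B_inner cscale scaleC_add_right[symmetric])
  ultimately obtain Y where Y: "Y \<in> C" "norm Y \<le> 1" "Y = (1/2) *\<^sub>R (B + (Y o\<^sub>L Y))"
    using quadratic_fixed_point_exists[OF norm_B] by blast
  define S where "S = c *\<^sub>R (id_blinfun - Y)"
  have YY: "Y (Y x) = 2 *\<^sub>R Y x - B x" for x
  proof -
    have "2 *\<^sub>R Y x = B x + Y (Y x)"
      by (subst Y(3)) (simp add: blinfun.add_left blinfun.scaleR_left)
    then show ?thesis by simp
  qed
  have "positive_op S"
  proof (rule positive_opI)
    show "clinear_op S"
      using Y(1) by (auto simp: clinear_op_def S_def C_def blinfun.diff_left blinfun.scaleR_left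
          cdiff cscale)
    show "inner (S x) y = inner x (S y)" for x y
      using Y(1) by (auto simp: S_def C_def blinfun.diff_left blinfun.scaleR_left
          inner_diff_left inner_diff_right)
    show "0 \<le> inner x (S x)" for x
    proof -
      have "inner x (Y x) \<le> norm x * (1 * norm x)"
        using order_trans[OF norm_blinfun[of Y x] mult_right_mono[OF Y(2) norm_ge_zero]]
        by (intro order_trans[OF norm_cauchy_schwarz] mult_left_mono) auto
      then show ?thesis
        using c by (simp add: S_def blinfun.diff_left blinfun.scaleR_left inner_diff_right
            dot_square_norm power2_eq_square)
    qed
  qed
  moreover have "S o\<^sub>L S = adj A o\<^sub>L A"
  proof (rule blinfun_eqI)
    fix x
    have "S (S x) = c\<^sup>2 *\<^sub>R (x - 2 *\<^sub>R Y x + Y (Y x))"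
      by (simp add: S_def blinfun.diff_left blinfun.scaleR_left blinfun.diff_right
          blinfun.scaleR_right scaleR_2 power2_eq_square algebra_simps)
    also have "\<dots> = c\<^sup>2 *\<^sub>R T x"
      by (simp add: YY B_def blinfun.diff_left)
    finally show "(S o\<^sub>L S) x = (adj A o\<^sub>L A) x"
      using c by (simp add: T_def blinfun.scaleR_left)
  qed
  ultimately show ?thesis by blast
qed

text \<open>For \<open>X = P - R\<close> the equal squares give \<open>P X + X R = 0\<close>.
  Pairing with \<open>X x\<close> and using positivity of \<open>P\<close>, the inner product of
  \<open>X x\<close> and \<open>X (R x)\<close> is nonpositive; near a maximiser it is close to
  \<open>s\<^sup>2 * inner x (R x)\<close>, which therefore tends to 0, and \<open>R x\<close> with
  it.\<close>

lemma maximizing_sequence_kernel: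
  fixes P R :: "'a::complex_hilbert \<Rightarrow>\<^sub>L 'a"
  assumes P: "positive_op P" and R: "positive_op R" and eq: "P o\<^sub>L P = R o\<^sub>L R" and ne: "P \<noteq> R"
    and x1: "\<And>n. norm (x n) = 1" and lim: "(\<lambda>n. norm ((P - R) (x n))) \<longlonglongrightarrow> norm (P - R)"
  shows "(\<lambda>n. norm (R (x n))) \<longlonglongrightarrow> 0"
proof -
  define X where "X = P - R"
  define s where "s = norm X"
  define \<delta> where "\<delta> n = sqrt (s\<^sup>2 - (norm (X (x n)))\<^sup>2)" for n
  have s: "s > 0" using ne by (simp add: s_def X_def)
  have "(\<lambda>n. norm (X (x n))) \<longlonglongrightarrow> s" using lim by (simp add: X_def s_def)
  then have "\<delta> \<longlonglongrightarrow> sqrt (s\<^sup>2 - s\<^sup>2)"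
    unfolding \<delta>_def by (intro tendsto_intros)
  then have \<delta>: "\<delta> \<longlonglongrightarrow> 0" by simp
  have \<delta>_ge_0: "\<delta> n \<ge> 0" for n
    using power_mono[OF norm_blinfun[of X "x n"], of 2] by (simp add: \<delta>_def s_def x1)
  have bound: "(norm (R (x n)))\<^sup>2 \<le> (norm R)\<^sup>2 / s * \<delta> n" for n
  proof -
    let ?x = "x n"
    have "P (X ?x) + X (R ?x) = P (P ?x) - R (R ?x)"
      by (simp add: X_def blinfun.diff_left blinfun.diff_right)
    also have "\<dots> = 0" using eq by (metis blinfun_apply_blinfun_compose cancel_comm_monoid_add_class.diff_cancel)
    finally have "inner (X ?x) (P (X ?x)) + inner (X ?x) (X (R ?x)) = 0"
      by (simp flip: inner_add_right)
    moreover have "0 \<le> inner (X ?x) (P (X ?x))" by (rule positive_op_ge_0[OF P])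
    moreover have "\<bar>s\<^sup>2 * inner ?x (R ?x) - inner (X ?x) (X (R ?x))\<bar> \<le> \<delta> n * (s * norm (R ?x))"
      unfolding s_def \<delta>_def by (rule near_maximizer_inner) (simp add: x1)
    moreover have "\<delta> n * (s * norm (R ?x)) \<le> \<delta> n * (s * norm R)"
      using norm_blinfun[of R ?x] s by (intro mult_left_mono \<delta>_ge_0) (auto simp: x1)
    ultimately have "s\<^sup>2 * inner ?x (R ?x) \<le> \<delta> n * (s * norm R)" by linarith
    then have "s * inner ?x (R ?x) \<le> \<delta> n * norm R"
      using s by (simp add: power2_eq_square mult.left_commute mult.assoc)
    then have "inner ?x (R ?x) \<le> \<delta> n * norm R / s"
      using s by (simp add: pos_le_divide_eq mult.commute)
    then have "norm R * inner ?x (R ?x) \<le> norm R * (\<delta> n * norm R / s)"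
      by (rule mult_left_mono) simp
    moreover have "(norm (R ?x))\<^sup>2 \<le> norm R * inner ?x (R ?x)"
      by (rule psd_norm_sq_le[OF subspace_UNIV]) (auto intro: positive_op_ge_0 positive_op_symmetric R)
    ultimately show ?thesis by (simp add: power2_eq_square ac_simps)
  qed
  have "(\<lambda>n. (norm R)\<^sup>2 / s * \<delta> n) \<longlonglongrightarrow> (norm R)\<^sup>2 / s * 0"
    by (intro tendsto_intros \<delta>)
  then have "(\<lambda>n. (norm R)\<^sup>2 / s * \<delta> n) \<longlonglongrightarrow> 0" by simp
  then have "(\<lambda>n. (norm (R (x n)))\<^sup>2) \<longlonglongrightarrow> 0"
    by (rule tendsto_sandwich[OF _ _ tendsto_const, rotated 2]) (use bound in auto)
  from tendsto_real_sqrt[OF this] show ?thesis by simp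
qed

text \<open>If the roots differed, both would tend to zero along one sequence maximising
  \<open>P - R\<close>, against the nonzero limit of the norms.\<close>

lemma positive_sqrt_unique:
  fixes P R :: "'a::complex_hilbert \<Rightarrow>\<^sub>L 'a"
  assumes P: "positive_op P" and R: "positive_op R" and eq: "P o\<^sub>L P = R o\<^sub>L R"
  shows "P = R"
proof (rule ccontr)
  assume ne: "P \<noteq> R"
  then obtain x where x1: "\<And>n. norm (x n) = 1"
    and lim: "(\<lambda>n. norm ((P - R) (x n))) \<longlonglongrightarrow> norm (P - R)"
    using norm_maximizing_sequence[of "P - R"] by auto
  have lim': "(\<lambda>n. norm ((R - P) (x n))) \<longlonglongrightarrow> norm (R - P)"
    using lim by (simp add: blinfun.diff_left norm_minus_commute)
  have "(\<lambda>n. norm (P (x n)) + norm (R (x n))) \<longlonglongrightarrow> 0 + 0"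
    using maximizing_sequence_kernel[OF P R eq ne x1 lim]
      maximizing_sequence_kernel[OF R P eq[symmetric] ne[symmetric] x1 lim']
    by (intro tendsto_add)
  moreover have "norm ((P - R) (x n)) \<le> norm (P (x n)) + norm (R (x n))" for n
    by (simp add: blinfun.diff_left norm_triangle_ineq4)
  ultimately have "norm (P - R) \<le> 0 + 0"
    by (intro LIMSEQ_le[OF lim]) auto
  then show False using ne by simp
qed

lemma op_abs:
  assumes "clinear_op A"
  shows positive_op_abs: "positive_op (op_abs A)"
    and op_abs_squared: "op_abs A o\<^sub>L op_abs A = adj A o\<^sub>L A"
proof -
  have "\<exists>!S. positive_op S \<and> S o\<^sub>L S = adj A o\<^sub>L A"
    using positive_sqrt_exists[OF assms] positive_sqrt_unique by metis
  from theI'[OF this] show "positive_op (op_abs A)" "op_abs A o\<^sub>L op_abs A = adj A o\<^sub>L A"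
    by (simp_all add: op_abs_def op_sqrt_def)
qed

lemma norm_op_abs_apply:
  assumes "clinear_op A"
  shows "norm (op_abs A x) = norm (A x)"
proof -
  have "(norm (op_abs A x))\<^sup>2 = inner x ((op_abs A o\<^sub>L op_abs A) x)"
    by (simp add: power2_norm_eq_inner positive_op_symmetric[OF positive_op_abs[OF assms]])
  also have "\<dots> = (norm (A x))\<^sup>2"
    by (simp add: op_abs_squared assms adj_inner[symmetric] dot_square_norm)
  finally show ?thesis by simp
qed

section \<open>Operators with closed range\<close>

lemma subspace_range_blinfun: "subspace (range (blinfun_apply A))"
  by (intro linear_subspace_image subspace_UNIV bounded_linear.linear blinfun.bounded_linear_right)

text \<open>Distances between images agree for \<open>A\<close> and \<open>B\<close>, so convergence
  passes between the two ranges. This carries closedness from \<open>A\<close> to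
  \<open>op_abs A\<close>.\<close>

lemma closed_range_norm_eq:
  fixes A :: "'a::real_normed_vector \<Rightarrow>\<^sub>L 'b::real_normed_vector"
    and B :: "'a \<Rightarrow>\<^sub>L 'c::banach"
  assumes eq: "\<And>x. norm (A x) = norm (B x)" and B: "closed (range B)"
  shows "closed (range A)"
  unfolding closed_sequential_limits
proof safe
  fix f v
  assume "\<forall>n. f n \<in> range A" and lim: "f \<longlonglongrightarrow> v"
  then have "\<forall>n. \<exists>x. f n = A x" by blast
  then obtain x where f: "\<And>n. f n = A (x n)" by metis
  have dist_eq: "dist (A u) (A u') = dist (B u) (B u')" for u u'
    using eq[of "u - u'"] by (simp add: dist_norm blinfun.diff_right)
  from LIMSEQ_imp_Cauchy[OF lim] have "Cauchy (\<lambda>n. B (x n))"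
    by (simp add: Cauchy_def f dist_eq)
  then obtain w where w: "(\<lambda>n. B (x n)) \<longlonglongrightarrow> w"
    using Cauchy_convergent_iff convergent_def by blast
  then have "w \<in> range B" using closed_sequentially[OF B _ w] by blast
  then obtain u where "w = B u" by blast
  with w have "(\<lambda>n. B (x n)) \<longlonglongrightarrow> B u" by simp
  then have "(\<lambda>n. dist (B (x n)) (B u)) \<longlonglongrightarrow> 0" by (rule tendsto_dist_iff[THEN iffD1])
  then have "(\<lambda>n. dist (f n) (A u)) \<longlonglongrightarrow> 0" by (simp add: f dist_eq)
  then have "f \<longlonglongrightarrow> A u" by (rule tendsto_dist_iff[THEN iffD2])
  with lim have "v = A u" by (rule LIMSEQ_unique)
  then show "v \<in> range A" by blast
qed

text \<open>If the conclusion fails, a series \<open>\<Sum>n. \<plusminus>y\<^sub>n / 3\<^sup>n\<close> of unit vectors with \<open>norm (S y\<^sub>n) < 1 / 4\<^sup>n\<close> converges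
  to a point \<open>l = S x\<close> of the range whose inner products with the \<open>y\<^sub>n\<close> are too large.\<close>

lemma symmetric_closed_range_bounded_below:
  fixes S :: "'a::{real_inner,banach} \<Rightarrow>\<^sub>L 'a"
  assumes sym: "\<And>x y. inner (S x) y = inner x (S y)" and cl: "closed (range S)"
  shows "\<exists>c>0. \<forall>y\<in>range S. c * norm y \<le> norm (S y)"
proof (rule ccontr)
  assume neg: "\<not> ?thesis"
  have "\<exists>y\<in>range S. norm y = 1 \<and> norm (S y) < 1 / 4 ^ n" for n :: nat
  proof -
    obtain y where y: "y \<in> range S" "norm (S y) < 1 / 4 ^ n * norm y"
      using neg by (metis not_le zero_less_divide_1_iff zero_less_numeral zero_less_power)
    then have "y \<noteq> 0" by auto
    obtain u where u: "y = S u" using y(1) by auto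
    have "S ((1 / norm y) *\<^sub>R u) = (1 / norm y) *\<^sub>R y" by (simp add: u blinfun.scaleR_right)
    then have "(1 / norm y) *\<^sub>R y \<in> range S" by (metis rangeI)
    moreover have "norm (S ((1 / norm y) *\<^sub>R y)) < 1 / 4 ^ n"
      using y(2) \<open>y \<noteq> 0\<close> by (simp add: blinfun.scaleR_right field_simps)
    ultimately show ?thesis using \<open>y \<noteq> 0\<close> by (intro bexI[of _ "(1 / norm y) *\<^sub>R y"]) auto
  qed
  then obtain y where y: "y n \<in> range S" "norm (y n) = 1" "norm (S (y n)) < 1 / 4 ^ n" for n
    by metis
  \<comment> \<open>The sign agrees with the inner product of the partial sum with
    \<open>y n\<close>, so the new term cannot cancel it.\<close>
  define w where "w = rec_nat 0 (\<lambda>n w. w + ((if inner w (y n) \<ge> 0 then 1 else - 1) / 3 ^ n) *\<^sub>R y n)"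
  have w0: "w 0 = 0"
    and wS: "w (Suc n) = w n + ((if inner (w n) (y n) \<ge> 0 then 1 else - 1) / 3 ^ n) *\<^sub>R y n" for n
    by (simp_all add: w_def)
  have sub: "subspace (range S)"
    by (rule subspace_range_blinfun)
  have w_range: "w n \<in> range S" for n
    by (induction n) (simp_all only: w0 wS subspace_0[OF sub] subspace_add[OF sub]
        subspace_scale[OF sub] y(1))
  have w_inner: "1 / 3 ^ n \<le> \<bar>inner (w (Suc n)) (y n)\<bar>" for n
  proof -
    have "inner (w (Suc n)) (y n) = inner (w n) (y n) + (if inner (w n) (y n) \<ge> 0 then 1 else - 1) / 3 ^ n"
      using y(2)[of n] by (simp add: wS inner_add_left dot_square_norm)
    moreover have "(0::real) \<le> 1 / 3 ^ n" by simp
    ultimately show ?thesis by (auto simp: abs_if split: if_splits)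
  qed
  \<comment> \<open>The right side is the sum of \<open>1 / 3 ^ j\<close> for \<open>j\<close> from
    \<open>n + 1\<close> to \<open>n + k\<close>.\<close>
  have w_tail: "norm (w (Suc n + k) - w (Suc n)) \<le> (1 / 3 ^ n) * (1 - 1 / 3 ^ k) / 2" for n k
  proof (induction k)
    case (Suc k)
    have "norm (w (Suc n + Suc k) - w (Suc n)) \<le> norm (w (Suc n + Suc k) - w (Suc n + k))
      + norm (w (Suc n + k) - w (Suc n))"
      using norm_triangle_ineq[of "w (Suc n + Suc k) - w (Suc n + k)" "w (Suc n + k) - w (Suc n)"]
      by simp
    also have "norm (w (Suc n + Suc k) - w (Suc n + k)) = 1 / 3 ^ (Suc n + k)"
      using wS[of "Suc n + k"] y(2)[of "Suc n + k"] by simp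
    finally show ?case using Suc by (simp add: power_add field_simps)
  qed simp
  have tail: "norm (w m - w (Suc n)) \<le> (1 / 3 ^ n) / 2" if "m \<ge> Suc n" for m n
  proof -
    obtain k where "m = Suc n + k" using le_Suc_ex[OF \<open>Suc n \<le> m\<close>] by blast
    moreover have "(1 / 3 ^ n) * (1 - 1 / 3 ^ k) / 2 \<le> (1 / 3 ^ n) / (2::real)"
      by (intro divide_right_mono mult_left_le) auto
    ultimately show ?thesis using w_tail[of n k] by simp
  qed
  have "Cauchy w"
  proof (rule CauchyI)
    fix e :: real assume "e > 0"
    then obtain n where n: "(1/3) ^ n < e" using real_arch_pow_inv[of e "1/3"] by auto
    have "norm (w i - w j) < e" if "i \<ge> Suc n" "j \<ge> Suc n" for i j
      using tail[OF that(1)] tail[OF that(2)] n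
        norm_triangle_ineq4[of "w i - w (Suc n)" "w j - w (Suc n)"]
      by (simp add: power_one_over)
    then show "\<exists>M. \<forall>i\<ge>M. \<forall>j\<ge>M. norm (w i - w j) < e"
      by (intro exI[of _ "Suc n"]) auto
  qed
  then obtain l where l: "w \<longlonglongrightarrow> l" using Cauchy_convergent_iff convergent_def by blast
  then have "l \<in> range S" using closed_sequentially[OF cl _ l] w_range by blast
  then obtain x where x: "l = S x" by blast
  \<comment> \<open>The tail costs at most half of the \<open>1 / 3 ^ n\<close> in
    \<open>w_inner\<close>, while symmetry moves \<open>S\<close> onto \<open>y n\<close>, where it
    is below \<open>1 / 4 ^ n\<close>.\<close>
  have "(4/3) ^ n \<le> 2 * norm x" for n :: nat
  proof -
    have "norm (l - w (Suc n)) \<le> (1 / 3 ^ n) / 2"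
      by (rule Lim_bounded[OF tendsto_norm[OF tendsto_diff[OF l tendsto_const]]]) (intro allI impI, erule tail)
    then have "\<bar>inner (l - w (Suc n)) (y n)\<bar> \<le> (1 / 3 ^ n) / 2"
      using Cauchy_Schwarz_ineq2[of "l - w (Suc n)" "y n"] y(2)[of n] by simp
    then have "(1 / 3 ^ n) / 2 \<le> \<bar>inner l (y n)\<bar>"
      using w_inner[of n] by (simp add: inner_diff_left)
    also have "\<bar>inner l (y n)\<bar> \<le> norm x * norm (S (y n))"
      unfolding x sym by (rule Cauchy_Schwarz_ineq2)
    also have "\<dots> \<le> norm x * (1 / 4 ^ n)"
      using y(3)[of n] by (intro mult_left_mono) auto
    finally show ?thesis by (simp add: field_simps)
  qed
  moreover obtain n where "2 * norm x < (4/3) ^ n" using real_arch_pow[of "4/3" "2 * norm x"] by auto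
  ultimately show False by (meson not_le)
qed

section \<open>Closed range and the spectrum of the modulus\<close>

text \<open>The lower bound makes \<open>G\<close> injective with complete, hence closed, range;
  \<open>dense\<close> makes the complement of the range trivial.\<close>

lemma invertible_of_bounded_below:
  fixes G :: "'a::{real_inner,banach} \<Rightarrow>\<^sub>L 'a"
  assumes d: "d > 0" and below: "\<And>x. d * norm x \<le> norm (G x)"
    and dense: "\<And>r. (\<And>u. inner (G u) r = 0) \<Longrightarrow> r = 0"
  shows "\<exists>T :: 'a \<Rightarrow>\<^sub>L 'a. (\<forall>x. T (G x) = x) \<and> (\<forall>y. G (T y) = y)"
proof -
  have inj: "x = y" if "G x = G y" for x y
  proof -
    have "d * norm (x - y) \<le> 0" using below[of "x - y"] that by (simp add: blinfun.diff_right)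
    then show ?thesis using d by (simp add: mult_le_0_iff)
  qed
  have "complete (range G)"
    by (rule complete_isometric_image[OF d subspace_UNIV blinfun.bounded_linear_right])
      (use below complete_UNIV in auto)
  then have "closed (range G)" by (rule complete_imp_closed)
  have "\<exists>x. G x = y" for y
  proof -
    obtain p where p: "p \<in> range G" "\<forall>z\<in>range G. inner z (y - p) = 0"
      using orthogonal_projection_exists[OF subspace_range_blinfun \<open>closed (range G)\<close>] by blast
    then have "y - p = 0" by (intro dense) blast
    with p(1) show ?thesis by auto
  qed
  then obtain h where h: "\<And>y. G (h y) = y" by metis
  have "bounded_linear h"
  proof (rule bounded_linear_intro)
    show "h (x + y) = h x + h y" for x y by (rule inj) (simp add: h blinfun.add_right)
    show "h (r *\<^sub>R x) = r *\<^sub>R h x" for r x by (rule inj) (simp add: h blinfun.scaleR_right)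
    show "norm (h x) \<le> norm x * (1 / d)" for x
      using below[of "h x"] d by (simp add: h field_simps)
  qed
  then have "Blinfun h x = h x" for x by (simp add: bounded_linear_Blinfun_apply)
  moreover have "h (G x) = x" for x by (rule inj) (simp add: h)
  ultimately show ?thesis using h by (intro exI[of _ "Blinfun h"]) simp
qed

lemma symmetric_range_kernel_decomposition:
  fixes S :: "'a::{real_inner,banach} \<Rightarrow>\<^sub>L 'a"
  assumes sym: "\<And>x y. inner (S x) y = inner x (S y)" and cl: "closed (range S)"
  obtains p n where "p \<in> range S" "S n = 0" "x = p + n"
proof -
  obtain p where p: "p \<in> range S" "\<And>z. z \<in> range S \<Longrightarrow> inner z (x - p) = 0"
    using orthogonal_projection_exists[OF subspace_range_blinfun cl] by blast
  \<comment> \<open>The residual is tested against \<open>S (S (x - p))\<close>, an element of the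
    range.\<close>
  have "inner (S (x - p)) (S (x - p)) = 0"
    using p(2)[of "S (S (x - p))"] by (simp add: sym)
  then show ?thesis using p(1) that[of p "x - p"] by simp
qed

text \<open>For \<open>S = op_abs A\<close> this identifies the range with the initial space of the
  polar factor.\<close>

lemma range_eq_ocomp_null_space:
  fixes S :: "'a::complex_hilbert \<Rightarrow>\<^sub>L 'a"
  assumes S: "positive_op S" and cl: "closed (range S)"
  shows "range S = ocomp (null_space S)"
proof -
  note sym = positive_op_symmetric[OF S]
  have ocomp: "x \<in> ocomp (null_space S) \<longleftrightarrow> (\<forall>y. S y = 0 \<longrightarrow> inner y x = 0)" for x
    using S by (intro ocomp_null_space_iff) (simp add: positive_op_def)
  show ?thesis
  proof safe
    show "S x \<in> ocomp (null_space S)" for x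
      by (simp add: ocomp sym[symmetric])
    fix x assume x: "x \<in> ocomp (null_space S)"
    obtain p n where pn: "p \<in> range S" "S n = 0" "x = p + n"
      using symmetric_range_kernel_decomposition[OF sym cl] by blast
    then obtain u where u: "p = S u" by blast
    have "inner n x = 0" using x pn(2) by (simp add: ocomp)
    moreover have "inner n p = 0" using pn(2) by (simp add: u sym[symmetric])
    ultimately have "n = 0" by (simp add: pn(3) inner_add_right)
    with pn show "x \<in> range S" by simp
  qed
qed

text \<open>\<open>S - z\<close> respects the orthogonal splitting into kernel and range: it is
  \<open>- z\<close> on the kernel, and on the range its form is at least \<open>m - Re z\<close>
  times the squared norm. Both parts are bounded below.\<close>

lemma not_in_spectrum:
  fixes S :: "'a::complex_hilbert \<Rightarrow>\<^sub>L 'a"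
  assumes S: "positive_op S" and cl: "closed (range S)"
    and m: "\<And>x. x \<in> range S \<Longrightarrow> m * (norm x)\<^sup>2 \<le> inner x (S x)"
    and z: "z \<noteq> 0" "Re z < m"
  shows "z \<notin> spectrum S"
proof -
  note sym = positive_op_symmetric[OF S]
  have lin: "clinear_op S" using S by (simp add: positive_op_def)
  define G where "G = S - Blinfun (\<lambda>x. z *\<^sub>C x)"
  have G: "G x = S x - z *\<^sub>C x" for x
    by (simp add: G_def blinfun.diff_left bounded_linear_Blinfun_apply bounded_linear_scaleC)
  have G_scaleC: "G (c *\<^sub>C x) = c *\<^sub>C G x" for c x
    by (simp add: G clinear_opD[OF lin] scaleC_scaleC mult.commute
        linear_simps(2)[OF bounded_linear_scaleC])
  have inner_scaleC_self: "inner p (c *\<^sub>C p) = Re c * (norm p)\<^sup>2" for c and p :: 'a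
  proof -
    have "cinner p p = complex_of_real ((norm p)\<^sup>2)"
      using inner_i_scaleC[of p p] 
      by (simp add: complex_eq_iff Re_cinner Im_cinner power2_norm_eq_inner inner_commute)
    then show ?thesis by (simp flip: Re_cinner add: cinner_scaleC_right)
  qed
  have orth: "inner n p = 0" if "S n = 0" "p \<in> range S" for n p
    using that by (auto simp flip: sym)
  have G_range: "G p \<in> range S" if "p \<in> range S" for p
  proof -
    obtain u where "p = S u" using \<open>p \<in> range S\<close> by blast
    then have "G p = S (S u - z *\<^sub>C u)" by (simp add: G clinear_opD[OF lin] blinfun.diff_right)
    then show ?thesis by simp
  qed
  have G_inner: "(m - Re z) * (norm p)\<^sup>2 \<le> inner p (G p)" if "p \<in> range S" for p
    using m[OF that] by (simp add: G inner_diff_right inner_scaleC_self algebra_simps)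
  define d where "d = min (cmod z) (m - Re z)"
  have d: "d > 0" "d \<le> cmod z" "d \<le> m - Re z" using z by (auto simp: d_def)
  have "\<exists>T :: 'a \<Rightarrow>\<^sub>L 'a. (\<forall>x. T (G x) = x) \<and> (\<forall>y. G (T y) = y)"
  proof (rule invertible_of_bounded_below[OF d(1)])
    fix x
    obtain p n where pn: "p \<in> range S" "S n = 0" "x = p + n"
      using symmetric_range_kernel_decomposition[OF sym cl] by blast
    have "inner (G n) (G p) = 0"
      by (rule orth) (simp_all add: G pn clinear_opD[OF lin] blinfun.minus_right
          linear_simps(3)[OF bounded_linear_scaleC] G_range[OF pn(1), unfolded G])
    then have "(norm (G x))\<^sup>2 = (norm (G n))\<^sup>2 + (norm (G p))\<^sup>2"
      by (simp add: pn(3) blinfun.add_right power2_norm_eq_inner inner_add_left inner_add_right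
          inner_commute)
    moreover have "(norm x)\<^sup>2 = (norm n)\<^sup>2 + (norm p)\<^sup>2"
      using orth[OF pn(2,1)]
      by (simp add: pn(3) power2_norm_eq_inner inner_add_left inner_add_right inner_commute)
    moreover have "d * norm n \<le> norm (G n)"
      using d(2) by (simp add: G pn(2) norm_scaleC mult_right_mono)
    then have "(d * norm n)\<^sup>2 \<le> (norm (G n))\<^sup>2" using d(1) by (intro power_mono) auto
    moreover have "d * norm p \<le> norm (G p)"
    proof (cases "p = 0")
      case False
      have "d * (norm p)\<^sup>2 \<le> (m - Re z) * (norm p)\<^sup>2" using d(3) by (intro mult_right_mono) auto
      also have "\<dots> \<le> norm p * norm (G p)"
        using G_inner[OF pn(1)] norm_cauchy_schwarz[of p "G p"] by linarith
      finally show ?thesis using False by (simp add: power2_eq_square)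
    qed simp
    then have "(d * norm p)\<^sup>2 \<le> (norm (G p))\<^sup>2" using d(1) by (intro power_mono) auto
    ultimately have "(d * norm x)\<^sup>2 \<le> (norm (G x))\<^sup>2"
      by (simp add: power_mult_distrib distrib_left)
    then show "d * norm x \<le> norm (G x)" by (rule power2_le_imp_le) simp
  next
    fix r assume r: "\<And>u. inner (G u) r = 0"
    obtain p n where pn: "p \<in> range S" "S n = 0" "r = p + n"
      using symmetric_range_kernel_decomposition[OF sym cl] by blast
    have "inner n p = 0" by (rule orth[OF pn(2,1)])
    \<comment> \<open>The multiplier \<open>- cnj z\<close> makes \<open>G\<close> a positive real
      factor on the kernel, so \<open>r\<close> is tested against \<open>n\<close> itself.\<close>
    have "G ((- cnj z) *\<^sub>C n) = ((cmod z)\<^sup>2) *\<^sub>R n"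
    proof -
      have "G ((- cnj z) *\<^sub>C n) = - ((- (complex_of_real ((cmod z)\<^sup>2))) *\<^sub>C n)"
        by (simp del: of_real_power add: G clinear_opD[OF lin] pn(2) scaleC_scaleC complex_norm_square
            linear_simps(3)[OF bounded_linear_scaleC])
      also have "\<dots> = ((cmod z)\<^sup>2) *\<^sub>R n"
        by (simp only: of_real_minus[symmetric] scaleC_of_real) simp
      finally show ?thesis .
    qed
    with r[of "(- cnj z) *\<^sub>C n"] have "n = 0"
      using z(1) \<open>inner n p = 0\<close> by (simp add: pn(3) inner_add_right)
    moreover have "(m - Re z) * (norm p)\<^sup>2 \<le> 0"
      using G_inner[OF pn(1)] r[of p] \<open>n = 0\<close> by (simp add: pn(3) inner_commute)
    then have "p = 0" using z(2) by (simp add: mult_le_0_iff)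
    ultimately show "r = 0" by (simp add: pn(3))
  qed
  then obtain T :: "'a \<Rightarrow>\<^sub>L 'a" where T: "\<And>x. T (G x) = x" "\<And>y. G (T y) = y" by blast
  have "clinear_op T"
    unfolding clinear_op_def by (metis G_scaleC T)
  then show ?thesis
    using T unfolding G spectrum_def by auto
qed

text \<open>The infimum is attained at the lower bound of \<open>x \<mapsto> \<langle>x, S x\<rangle>\<close> on the unit sphere of the range,
  which is an approximate eigenvalue of \<open>S\<close>.\<close>

lemma Inf_spectrum_bounded_below:
  fixes S :: "'a::complex_hilbert \<Rightarrow>\<^sub>L 'a"
  assumes S: "positive_op S" and ne: "S \<noteq> 0" and cl: "closed (range S)"
  defines "m \<equiv> Inf (Re ` (spectrum S - {0}))"
  shows "0 < m" and "\<And>x. x \<in> range S \<Longrightarrow> m * (norm x)\<^sup>2 \<le> inner x (S x)"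
proof -
  note sym = positive_op_symmetric[OF S] and nonneg = positive_op_ge_0[OF S]
  define U where "U = {x \<in> range S. norm x = 1}"
  define \<mu> where "\<mu> = (INF x\<in>U. inner x (S x))"
  have unit: "(1 / norm x) *\<^sub>R x \<in> U" if x: "x \<in> range S" "x \<noteq> 0" for x
    using x subspace_scale[OF subspace_range_blinfun x(1)] by (auto simp: U_def)
  obtain x where "S x \<noteq> 0" using ne by (metis blinfun_eqI zero_blinfun.rep_eq)
  then have U: "U \<noteq> {}" using unit by blast
  obtain c where c: "c > 0" "\<And>y. y \<in> range S \<Longrightarrow> c * norm y \<le> norm (S y)"
    using symmetric_closed_range_bounded_below[OF sym cl] by blast
  have bdd: "bdd_below ((\<lambda>x. inner x (S x)) ` U)"
    by (rule bdd_belowI[of _ 0]) (use nonneg in auto)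
  have \<mu>_pos: "\<mu> > 0"
  proof -
    have "c\<^sup>2 / norm S \<le> inner x (S x)" if "x \<in> U" for x
    proof -
      have "c \<le> norm (S x)" using c(2)[of x] that by (simp add: U_def)
      then have "c\<^sup>2 \<le> (norm (S x))\<^sup>2" using c(1) by (intro power_mono) auto
      also have "\<dots> \<le> norm S * inner x (S x)"
        by (rule psd_norm_sq_le[OF subspace_UNIV]) (auto intro: nonneg sym)
      finally show ?thesis using ne by (simp add: field_simps)
    qed
    then have "c\<^sup>2 / norm S \<le> \<mu>" unfolding \<mu>_def by (intro cINF_greatest U)
    moreover have "0 < c\<^sup>2 / norm S" using c(1) ne by simp
    ultimately show ?thesis by linarith
  qed
  have \<mu>: "\<mu> * (norm x)\<^sup>2 \<le> inner x (S x)" if x: "x \<in> range S" for x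
  proof (cases "x = 0")
    case False
    have "\<mu> \<le> inner ((1 / norm x) *\<^sub>R x) (S ((1 / norm x) *\<^sub>R x))"
      unfolding \<mu>_def by (rule cINF_lower[OF bdd unit[OF x False]])
    then show ?thesis using False
      by (simp add: blinfun.scaleR_right power2_eq_square pos_le_divide_eq mult.assoc)
  qed simp
  have "complex_of_real \<mu> \<in> spectrum S"
  proof (rule ccontr)
    assume "\<not> ?thesis"
    then obtain T :: "'a \<Rightarrow>\<^sub>L 'a" where T: "\<And>x. T (S x - \<mu> *\<^sub>R x) = x"
      by (auto simp: spectrum_def scaleC_of_real)
    \<comment> \<open>\<open>T\<close> is a bounded left inverse of \<open>G\<close>, so
      \<open>norm (G x)\<close> is bounded below on \<open>U\<close>. By
      \<open>psd_norm_sq_le\<close> on the range of \<open>S\<close> the form of \<open>G\<close> is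
      too, which would raise the infimum \<open>\<mu>\<close>. The added 1 below keeps the
      denominator positive.\<close>
    define G where "G = S - \<mu> *\<^sub>R id_blinfun"
    have G: "G x = S x - \<mu> *\<^sub>R x" for x by (simp add: G_def blinfun.diff_left blinfun.scaleR_left)
    have "1 / ((norm T)\<^sup>2 * norm G + 1) + \<mu> \<le> inner x (S x)" if x: "x \<in> U" for x
    proof -
      have xS: "x \<in> range S" using x by (simp add: U_def)
      have "1 = norm (T (G x))" using x by (simp add: G T U_def)
      also have "\<dots> \<le> norm T * norm (G x)" by (rule norm_blinfun)
      finally have "1\<^sup>2 \<le> (norm T * norm (G x))\<^sup>2" by (intro power_mono) auto
      also have "\<dots> = (norm T)\<^sup>2 * (norm (G x))\<^sup>2" by (simp add: power_mult_distrib)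
      also have "\<dots> \<le> (norm T)\<^sup>2 * (norm G * inner x (G x))"
      proof (intro mult_left_mono psd_norm_sq_le[OF subspace_range_blinfun[of S] _ _ xS])
        show "0 \<le> inner v (G v)" if "v \<in> range S" for v
          using \<mu>[OF that] by (simp add: G inner_diff_right dot_square_norm)
        show "inner (G u) v = inner u (G v)" for u v
          by (simp add: G inner_diff_left inner_diff_right sym)
        show "G x \<in> range S"
          unfolding G by (intro subspace_diff subspace_scale subspace_range_blinfun xS rangeI)
      qed simp
      finally have "1 \<le> ((norm T)\<^sup>2 * norm G) * inner x (G x)" by (simp add: mult.assoc)
      moreover have "0 \<le> inner x (G x)"
        using \<mu>[OF xS] by (simp add: G inner_diff_right dot_square_norm)
      ultimately have "1 \<le> ((norm T)\<^sup>2 * norm G + 1) * inner x (G x)"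
        by (simp add: distrib_right)
      moreover have "0 < (norm T)\<^sup>2 * norm G + 1" by (simp add: add_nonneg_pos)
      ultimately have "1 / ((norm T)\<^sup>2 * norm G + 1) \<le> inner x (G x)"
        by (simp add: pos_divide_le_eq mult.commute)
      also have "inner x (G x) = inner x (S x) - \<mu>"
        using x by (simp add: G inner_diff_right dot_square_norm U_def)
      finally show ?thesis by simp
    qed
    then have "1 / ((norm T)\<^sup>2 * norm G + 1) + \<mu> \<le> \<mu>"
      unfolding \<mu>_def by (intro cINF_greatest U) (simp add: \<mu>_def)
    moreover have "0 < 1 / ((norm T)\<^sup>2 * norm G + 1)" by (simp add: add_nonneg_pos)
    ultimately show False by linarith
  qed
  moreover have "\<mu> \<le> Re z" if "z \<in> spectrum S - {0}" for z
    using not_in_spectrum[OF S cl \<mu>] that by (metis DiffE insertI1 not_le)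
  ultimately have "m = \<mu>"
    unfolding m_def using \<mu>_pos by (intro cInf_eq_minimum) (auto intro!: image_eqI[of _ _ "complex_of_real \<mu>"])
  with \<mu>_pos \<mu> show "0 < m" and "\<And>x. x \<in> range S \<Longrightarrow> m * (norm x)\<^sup>2 \<le> inner x (S x)"
    by simp_all
qed

section \<open>The difference of two polar factors\<close>

text \<open>\<open>eqn\<close> comes from a Sylvester equation tested against \<open>T x\<close>. At
  a near-maximiser \<open>inner (T x) (T (S x))\<close> is close to
  \<open>(norm T)\<^sup>2 * inner x (S x)\<close>, so coercivity adds
  \<open>\<sigma>\<^sub>2\<close> to \<open>\<sigma>\<^sub>1\<close>.\<close>

lemma sylvester_norm_bound:
  fixes T :: "'a::{real_inner,banach} \<Rightarrow>\<^sub>L 'b::real_inner" and S :: "'a \<Rightarrow>\<^sub>L 'a"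
  assumes M: "0 \<le> M" and \<sigma>\<^sub>2: "0 \<le> \<sigma>\<^sub>2"
    and W: "\<And>x. \<exists>x'\<in>W. norm x' \<le> norm x \<and> T x' = T x"
    and coercive: "\<And>x. x \<in> W \<Longrightarrow> \<sigma>\<^sub>2 * (norm x)\<^sup>2 \<le> inner x (S x)"
    and eqn: "\<And>x. x \<in> W \<Longrightarrow>
      \<sigma>\<^sub>1 * (norm (T x))\<^sup>2 + inner (T x) (T (S x)) \<le> M * norm (T x) * norm x"
  shows "(\<sigma>\<^sub>1 + \<sigma>\<^sub>2) * norm T \<le> M"
proof (cases "T = 0")
  case False
  define s where "s = norm T"
  have s: "s > 0" using False by (simp add: s_def)
  obtain x where x: "\<And>n. norm (x n) = 1" "(\<lambda>n. norm (T (x n))) \<longlonglongrightarrow> s"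
    using norm_maximizing_sequence[OF False] unfolding s_def by blast
  define a where "a = (\<lambda>n. norm (T (x n)))"
  have a: "a \<longlonglongrightarrow> s" using x(2) by (simp add: a_def)
  define \<delta> where "\<delta> n = sqrt (s\<^sup>2 - (a n)\<^sup>2)" for n
  have "\<delta> \<longlonglongrightarrow> sqrt (s\<^sup>2 - s\<^sup>2)"
    unfolding \<delta>_def by (intro tendsto_intros a)
  then have \<delta>: "\<delta> \<longlonglongrightarrow> 0" by simp
  have bound: "(\<sigma>\<^sub>1 + \<sigma>\<^sub>2) * (a n)\<^sup>2 \<le> M * a n + \<delta> n * (s * norm S)" for n
  proof -
    \<comment> \<open>Passing to \<open>v\<close> in \<open>W\<close> may shorten the vector but
      leaves its image, hence \<open>\<delta> n\<close>, unchanged; \<open>a_le\<close> makes up for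
      the shortening.\<close>
    obtain v where v: "v \<in> W" "norm v \<le> 1" "T v = T (x n)"
      using W[of "x n"] x(1) by auto
    have a_le: "a n \<le> s * norm v"
      using norm_blinfun[of T v] by (simp add: a_def v(3) s_def)
    have \<delta>_ge_0: "\<delta> n \<ge> 0"
      using power_mono[OF norm_blinfun[of T "x n"], of 2] by (simp add: \<delta>_def a_def s_def x)
    have "\<sigma>\<^sub>2 * (a n)\<^sup>2 \<le> \<sigma>\<^sub>2 * (s * norm v)\<^sup>2"
      by (intro mult_left_mono power_mono a_le \<sigma>\<^sub>2) (simp add: a_def)
    also have "\<dots> = s\<^sup>2 * (\<sigma>\<^sub>2 * (norm v)\<^sup>2)" by (simp add: power_mult_distrib)
    also have "\<dots> \<le> s\<^sup>2 * inner v (S v)"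
      by (intro mult_left_mono coercive v(1)) simp
    finally have "\<sigma>\<^sub>2 * (a n)\<^sup>2 \<le> s\<^sup>2 * inner v (S v)" .
    moreover have "\<bar>s\<^sup>2 * inner v (S v) - inner (T v) (T (S v))\<bar> \<le> \<delta> n * (s * norm (S v))"
      using near_maximizer_inner[OF v(2), of T "S v"] by (simp add: s_def \<delta>_def a_def v(3))
    moreover have "norm (S v) \<le> norm S"
      using norm_blinfun[of S v] mult_left_le[OF v(2), of "norm S"] by simp
    then have "\<delta> n * (s * norm (S v)) \<le> \<delta> n * (s * norm S)"
      using s by (intro mult_left_mono \<delta>_ge_0) auto
    moreover have "\<sigma>\<^sub>1 * (a n)\<^sup>2 + inner (T v) (T (S v)) \<le> M * a n * norm v"
      using eqn[OF v(1)] by (simp add: v(3) a_def)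
    moreover have "M * a n * norm v \<le> M * a n"
      using v(2) M by (intro mult_left_le) (auto simp: a_def)
    moreover have "(\<sigma>\<^sub>1 + \<sigma>\<^sub>2) * (a n)\<^sup>2 = \<sigma>\<^sub>1 * (a n)\<^sup>2 + \<sigma>\<^sub>2 * (a n)\<^sup>2"
      by (rule distrib_right)
    ultimately show ?thesis by linarith
  qed
  have "(\<sigma>\<^sub>1 + \<sigma>\<^sub>2) * s\<^sup>2 \<le> M * s + 0 * (s * norm S)"
    by (rule LIMSEQ_le[of "\<lambda>n. (\<sigma>\<^sub>1 + \<sigma>\<^sub>2) * (a n)\<^sup>2" _ "\<lambda>n. M * a n + \<delta> n * (s * norm S)"])
      (intro tendsto_intros a \<delta> exI[of _ 0] allI impI bound)+
  then show ?thesis using s by (simp add: s_def[symmetric] power2_eq_square)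
qed (use M in simp)

text \<open>The data of a polar decomposition \<open>A = Q S\<close> with \<open>S = |A|\<close>; \<open>B\<close> is the adjoint of \<open>Q\<close>, so
  \<open>B Q\<close> and \<open>Q B\<close> are the projections onto the initial and the final space.\<close>

locale polar =
  fixes A Q :: "'a::{real_inner,banach} \<Rightarrow>\<^sub>L 'b::real_inner" and B :: "'b \<Rightarrow>\<^sub>L 'a"
    and S :: "'a \<Rightarrow>\<^sub>L 'a" and \<sigma> :: real
  assumes A_eq: "\<And>x. A x = Q (S x)"
    and symmetric: "\<And>x y. inner (S x) y = inner x (S y)"
    and closed_range: "closed (range S)"
    and kernel: "\<And>x. S x = 0 \<Longrightarrow> Q x = 0"
    and isometric: "\<And>x. x \<in> range S \<Longrightarrow> norm (Q x) = norm x"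
    and adjoint: "\<And>x y. inner (Q x) y = inner x (B y)"
    and sigma_pos: "0 < \<sigma>"
    and sigma_le: "\<And>x. x \<in> range S \<Longrightarrow> \<sigma> * (norm x)\<^sup>2 \<le> inner x (S x)"
begin

lemma decomposition:
  obtains p n where "p \<in> range S" "S n = 0" "x = p + n" "inner p n = 0" "Q x = Q p"
    "(norm x)\<^sup>2 = (norm p)\<^sup>2 + (norm n)\<^sup>2"
proof -
  obtain p n where pn: "p \<in> range S" "S n = 0" "x = p + n"
    using symmetric_range_kernel_decomposition[OF symmetric closed_range] by blast
  have "inner p n = 0" using pn by (auto simp: symmetric)
  moreover from this have "(norm x)\<^sup>2 = (norm p)\<^sup>2 + (norm n)\<^sup>2"
    by (simp add: pn(3) power2_norm_eq_inner inner_add_left inner_add_right inner_commute)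
  moreover have "Q x = Q p" by (simp add: pn blinfun.add_right kernel)
  ultimately show ?thesis using pn that by blast
qed

text \<open>The kernel part of \<open>y\<close> drops out on both sides; the rest is polarisation of
  the isometry on the range of \<open>S\<close>.\<close>

lemma inner_Q:
  assumes x: "x \<in> range S"
  shows "inner (Q x) (Q y) = inner x y"
proof -
  obtain p n where pn: "p \<in> range S" "S n = 0" "y = p + n" "Q y = Q p"
    using decomposition[of y] by metis
  have "inner x n = 0" using x pn(2) by (auto simp: symmetric)
  have "x + p \<in> range S" using x pn(1) by (intro subspace_add subspace_range_blinfun)
  from isometric[OF this] have "(norm (Q x + Q p))\<^sup>2 = (norm (x + p))\<^sup>2"
    by (simp add: blinfun.add_right)
  moreover have "(norm (Q x))\<^sup>2 = (norm x)\<^sup>2" "(norm (Q p))\<^sup>2 = (norm p)\<^sup>2"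
    using isometric x pn(1) by auto
  ultimately have "inner (Q x) (Q p) = inner x p"
    by (simp add: power2_norm_eq_inner inner_add_left inner_add_right inner_commute)
  then show ?thesis using \<open>inner x n = 0\<close> by (simp add: pn(3) pn(4)[unfolded pn(3)] inner_add_right)
qed

lemma B_Q: "x \<in> range S \<Longrightarrow> B (Q x) = x"
  by (rule vector_eq_ldot[THEN iffD1]) (metis adjoint inner_Q inner_commute)

lemma Q_B_Q: "Q (B (Q x)) = Q x"
  by (metis B_Q decomposition)

lemma B_in_range: "B y \<in> range S"
proof -
  obtain p n where pn: "p \<in> range S" "S n = 0" "B y = p + n" "inner p n = 0"
    using decomposition[of "B y"] by metis
  have "inner n (B y) = 0" by (simp add: adjoint[symmetric] kernel pn(2))
  then have "n = 0" using pn(4) by (simp add: pn(3) inner_add_right inner_commute)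
  with pn show ?thesis by simp
qed

lemma norm_Q_le: "norm (Q x) \<le> norm x"
proof -
  obtain p n where pn: "p \<in> range S" "S n = 0" "x = p + n" "inner p n = 0" "Q x = Q p"
    "(norm x)\<^sup>2 = (norm p)\<^sup>2 + (norm n)\<^sup>2"
    by (rule decomposition)
  have "norm p \<le> norm x"
    by (rule power2_le_imp_le) (simp_all add: pn(6))
  then show ?thesis by (simp add: pn(5) isometric[OF pn(1)])
qed

lemma norm_B_Q: "norm (B (Q x)) = norm (Q x)"
  using isometric[OF B_in_range[of "Q x"]] by (simp add: Q_B_Q)

lemma Q_in_range: "Q x \<in> range A"
proof -
  obtain p where p: "p \<in> range S" "Q x = Q p" using decomposition[of x] by metis
  then obtain u where "p = S u" by blast
  then have "Q x = A u" by (simp add: p(2) A_eq)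
  then show ?thesis by simp
qed

lemma inner_range_residual: "inner (Q x) (y - Q (B y)) = 0"
  by (simp add: adjoint blinfun.diff_right B_Q B_in_range)

lemma norm_sq_split: "(norm y)\<^sup>2 = (norm (Q (B y)))\<^sup>2 + (norm (y - Q (B y)))\<^sup>2"
  using norm_add_Pythagorean[of "Q (B y)" "y - Q (B y)"] inner_range_residual[of "B y" y]
  by (simp add: orthogonal_def)

text \<open>Subtracting \<open>A u\<close> from \<open>y\<close> does not change the residual, and
  taking residuals is a contraction: \<open>Q (B y)\<close> is a best approximation in the
  range.\<close>

lemma norm_residual_le: "norm (y - Q (B y)) \<le> norm (y - A u)"
proof -
  have "y - Q (B y) = (y - A u) - Q (B (y - A u))"
    by (simp add: blinfun.diff_right A_eq B_Q)
  moreover have "norm (v - Q (B v)) \<le> norm v" for v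
    by (rule power2_le_imp_le) (simp_all add: norm_sq_split[of v])
  ultimately show ?thesis by (simp only:)
qed

lemma sigma_norm_le: "x \<in> range S \<Longrightarrow> \<sigma> * norm x \<le> norm (A x)"
proof (cases "x = 0")
  case False
  assume x: "x \<in> range S"
  have "\<sigma> * (norm x)\<^sup>2 \<le> norm x * norm (S x)"
    using sigma_le[OF x] norm_cauchy_schwarz[of x "S x"] by linarith
  then show ?thesis using False by (simp add: A_eq isometric power2_eq_square)
qed simp

end

text \<open>Only the part \<open>p\<close> of \<open>x\<close> in the initial space matters;
  \<open>A\<^sub>1\<close> is bounded below there and
  \<open>A\<^sub>1 p = (A\<^sub>1 - A\<^sub>2) x\<close>. This controls the gap from the second
  kernel to the first.\<close>

lemma polar_cross_kernel:
  fixes A\<^sub>1 A\<^sub>2 Q\<^sub>1 :: "'a::{real_inner,banach} \<Rightarrow>\<^sub>L 'b::real_inner"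
  assumes "polar A\<^sub>1 Q\<^sub>1 B\<^sub>1 S\<^sub>1 \<sigma>\<^sub>1" and "A\<^sub>2 x = 0"
  shows "\<sigma>\<^sub>1 * norm (Q\<^sub>1 x) \<le> norm (A\<^sub>1 - A\<^sub>2) * norm x"
proof -
  interpret polar A\<^sub>1 Q\<^sub>1 B\<^sub>1 S\<^sub>1 \<sigma>\<^sub>1 by fact
  obtain p n where pn: "p \<in> range S\<^sub>1" "S\<^sub>1 n = 0" "x = p + n" "Q\<^sub>1 x = Q\<^sub>1 p"
    using decomposition[of x] by metis
  have "\<sigma>\<^sub>1 * norm (Q\<^sub>1 x) \<le> norm (A\<^sub>1 p)"
    using sigma_norm_le[OF pn(1)] by (simp add: pn(4) isometric[OF pn(1)])
  also have "A\<^sub>1 p = (A\<^sub>1 - A\<^sub>2) x"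
    by (simp add: blinfun.diff_left assms(2)) (simp add: A_eq pn blinfun.add_right)
  also have "norm \<dots> \<le> norm (A\<^sub>1 - A\<^sub>2) * norm x" by (rule norm_blinfun)
  finally show ?thesis .
qed

text \<open>A preimage \<open>u\<close> of \<open>y\<close> in the initial space has norm at most
  \<open>norm y / \<sigma>\<^sub>1\<close>, and \<open>A\<^sub>2 u\<close> competes with the
  projection of \<open>y\<close>. The direction is opposite to the one for kernels, with the same
  \<open>\<sigma>\<^sub>1\<close>.\<close>

lemma polar_cross_range:
  fixes A\<^sub>1 A\<^sub>2 Q\<^sub>1 Q\<^sub>2 :: "'a::{real_inner,banach} \<Rightarrow>\<^sub>L 'b::real_inner"
  assumes "polar A\<^sub>1 Q\<^sub>1 B\<^sub>1 S\<^sub>1 \<sigma>\<^sub>1" and "polar A\<^sub>2 Q\<^sub>2 B\<^sub>2 S\<^sub>2 \<sigma>\<^sub>2" and y: "y \<in> range A\<^sub>1"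
  shows "\<sigma>\<^sub>1 * norm (y - Q\<^sub>2 (B\<^sub>2 y)) \<le> norm (A\<^sub>1 - A\<^sub>2) * norm y"
proof -
  interpret p1: polar A\<^sub>1 Q\<^sub>1 B\<^sub>1 S\<^sub>1 \<sigma>\<^sub>1 by fact
  interpret p2: polar A\<^sub>2 Q\<^sub>2 B\<^sub>2 S\<^sub>2 \<sigma>\<^sub>2 by fact
  obtain x where x: "y = A\<^sub>1 x" using y by blast
  obtain u n where un: "u \<in> range S\<^sub>1" "S\<^sub>1 n = 0" "x = u + n"
    using p1.decomposition[of x] by metis
  have yu: "y = A\<^sub>1 u" by (simp add: x un p1.A_eq blinfun.add_right)
  have "\<sigma>\<^sub>1 * norm (y - Q\<^sub>2 (B\<^sub>2 y)) \<le> \<sigma>\<^sub>1 * norm (y - A\<^sub>2 u)"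
    using p1.sigma_pos p2.norm_residual_le by (intro mult_left_mono) auto
  also have "y - A\<^sub>2 u = (A\<^sub>1 - A\<^sub>2) u" by (simp add: yu blinfun.diff_left)
  also have "\<sigma>\<^sub>1 * norm ((A\<^sub>1 - A\<^sub>2) u) \<le> \<sigma>\<^sub>1 * (norm (A\<^sub>1 - A\<^sub>2) * norm u)"
    using p1.sigma_pos by (intro mult_left_mono norm_blinfun) auto
  also have "\<dots> = norm (A\<^sub>1 - A\<^sub>2) * (\<sigma>\<^sub>1 * norm u)" by simp
  also have "\<dots> \<le> norm (A\<^sub>1 - A\<^sub>2) * norm y"
    unfolding yu by (intro mult_left_mono p1.sigma_norm_le un) simp
  finally show ?thesis .
qed

lemma polar_distance:
  fixes A\<^sub>1 A\<^sub>2 Q\<^sub>1 Q\<^sub>2 :: "'a::{real_inner,banach} \<Rightarrow>\<^sub>L 'b::real_inner"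
  assumes "polar A\<^sub>1 Q\<^sub>1 B\<^sub>1 S\<^sub>1 \<sigma>\<^sub>1" and "polar A\<^sub>2 Q\<^sub>2 B\<^sub>2 S\<^sub>2 \<sigma>\<^sub>2" and t: "0 \<le> t"
    and kernel: "\<And>n. S\<^sub>2 n = 0 \<Longrightarrow> norm (Q\<^sub>1 n) \<le> t * norm n"
    and range: "\<And>y. y \<in> range A\<^sub>2 \<Longrightarrow> norm (y - Q\<^sub>1 (B\<^sub>1 y)) \<le> t * norm y"
    and D: "2 * norm (A\<^sub>1 - A\<^sub>2) \<le> t * (\<sigma>\<^sub>1 + \<sigma>\<^sub>2)"
  shows "norm (Q\<^sub>1 - Q\<^sub>2) \<le> 2 * t"
proof -
  interpret p1: polar A\<^sub>1 Q\<^sub>1 B\<^sub>1 S\<^sub>1 \<sigma>\<^sub>1 by fact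
  interpret p2: polar A\<^sub>2 Q\<^sub>2 B\<^sub>2 S\<^sub>2 \<sigma>\<^sub>2 by fact
  define X where "X = Q\<^sub>1 - Q\<^sub>2"
  \<comment> \<open>The block of \<open>X\<close> from the initial space of \<open>Q\<^sub>2\<close>
    to the final space of \<open>Q\<^sub>1\<close>, pulled back by \<open>B\<^sub>1\<close>, which
    preserves norms on that final space.\<close>
  define T where "T = B\<^sub>1 o\<^sub>L X o\<^sub>L B\<^sub>2 o\<^sub>L Q\<^sub>2"
  have X: "X x = Q\<^sub>1 x - Q\<^sub>2 x" for x by (simp add: X_def blinfun.diff_left)
  have T: "T x = B\<^sub>1 (X x)" if "x \<in> range S\<^sub>2" for x
    using that by (simp add: T_def p2.B_Q)
  have "(\<sigma>\<^sub>1 + \<sigma>\<^sub>2) * norm T \<le> 2 * norm (A\<^sub>1 - A\<^sub>2)"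
  proof (rule sylvester_norm_bound[where W = "range S\<^sub>2" and S = S\<^sub>2])
    show "\<exists>x'\<in>range S\<^sub>2. norm x' \<le> norm x \<and> T x' = T x" for x
      using p2.B_in_range[of "Q\<^sub>2 x"] p2.norm_Q_le[of x]
      by (intro bexI[of _ "B\<^sub>2 (Q\<^sub>2 x)"]) (simp_all add: p2.norm_B_Q T_def p2.Q_B_Q)
    fix x assume x: "x \<in> range S\<^sub>2"
    show "\<sigma>\<^sub>2 * (norm x)\<^sup>2 \<le> inner x (S\<^sub>2 x)" by (rule p2.sigma_le[OF x])
    define u where "u = T x"
    have u: "u = B\<^sub>1 (X x)" "u \<in> range S\<^sub>1" using T[OF x] p1.B_in_range by (simp_all add: u_def)
    have "\<sigma>\<^sub>1 * (norm u)\<^sup>2 \<le> inner (S\<^sub>1 u) u"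
      using p1.sigma_le[OF u(2)] by (simp add: inner_commute)
    also have "\<dots> = inner (A\<^sub>1 u) (X x)"
      by (subst (2) u(1)) (simp add: p1.adjoint[symmetric] p1.A_eq)
    also have "\<dots> = inner (A\<^sub>1 u) (Q\<^sub>1 x) - inner (A\<^sub>1 u) (Q\<^sub>2 x)"
      by (simp add: X inner_diff_right)
    \<comment> \<open>Both sides equal \<open>inner (S\<^sub>1 u) x\<close>. The exchange lets the
      four terms pair up into two with \<open>A\<^sub>1 - A\<^sub>2\<close>, whence the factor
      2.\<close>
    also have "inner (A\<^sub>1 u) (Q\<^sub>1 x) = inner (Q\<^sub>1 u) (A\<^sub>1 x)"
      using u(2) by (simp add: p1.A_eq p1.inner_Q p1.symmetric)
    finally have 1: "\<sigma>\<^sub>1 * (norm u)\<^sup>2 \<le> inner (Q\<^sub>1 u) (A\<^sub>1 x) - inner (A\<^sub>1 u) (Q\<^sub>2 x)" .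
    have "inner u (T (S\<^sub>2 x)) = inner (Q\<^sub>1 u) (X (S\<^sub>2 x))"
      by (simp add: T p1.adjoint)
    also have "\<dots> = inner (Q\<^sub>1 u) (Q\<^sub>1 (S\<^sub>2 x)) - inner (Q\<^sub>1 u) (A\<^sub>2 x)"
      by (simp add: X inner_diff_right p2.A_eq)
    also have "inner (Q\<^sub>1 u) (Q\<^sub>1 (S\<^sub>2 x)) = inner (A\<^sub>2 u) (Q\<^sub>2 x)"
      using u(2) by (simp add: p1.inner_Q p2.A_eq p2.inner_Q p2.symmetric)
    finally have "inner u (T (S\<^sub>2 x)) = inner (A\<^sub>2 u) (Q\<^sub>2 x) - inner (Q\<^sub>1 u) (A\<^sub>2 x)" .
    with 1 have "\<sigma>\<^sub>1 * (norm u)\<^sup>2 + inner u (T (S\<^sub>2 x))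
        \<le> inner (Q\<^sub>1 u) ((A\<^sub>1 - A\<^sub>2) x) - inner ((A\<^sub>1 - A\<^sub>2) u) (Q\<^sub>2 x)"
      by (simp add: blinfun.diff_left inner_diff_left inner_diff_right)
    also have "\<dots> \<le> norm (Q\<^sub>1 u) * norm ((A\<^sub>1 - A\<^sub>2) x) + norm ((A\<^sub>1 - A\<^sub>2) u) * norm (Q\<^sub>2 x)"
      using norm_cauchy_schwarz[of "Q\<^sub>1 u" "(A\<^sub>1 - A\<^sub>2) x"]
        norm_cauchy_schwarz[of "- ((A\<^sub>1 - A\<^sub>2) u)" "Q\<^sub>2 x"] by simp
    also have "\<dots> \<le> norm u * (norm (A\<^sub>1 - A\<^sub>2) * norm x) + (norm (A\<^sub>1 - A\<^sub>2) * norm u) * norm x"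
      by (intro add_mono mult_mono p1.norm_Q_le p2.norm_Q_le norm_blinfun) auto
    finally show "\<sigma>\<^sub>1 * (norm (T x))\<^sup>2 + inner (T x) (T (S\<^sub>2 x))
        \<le> 2 * norm (A\<^sub>1 - A\<^sub>2) * norm (T x) * norm x"
      by (simp add: u_def ac_simps)
  qed (use p2.sigma_pos in auto)
  also note D
  finally have "norm T \<le> t"
    using p1.sigma_pos p2.sigma_pos by (simp add: mult.commute)
  show ?thesis
    unfolding X_def[symmetric]
  proof (rule norm_blinfun_bound)
    fix x
    obtain p n where pn: "p \<in> range S\<^sub>2" "S\<^sub>2 n = 0" "x = p + n"
      "(norm x)\<^sup>2 = (norm p)\<^sup>2 + (norm n)\<^sup>2"
      using p2.decomposition[of x] by metis
    \<comment> \<open>In the final space of \<open>Q\<^sub>1\<close>, \<open>p\<close> contributes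
      the Sylvester block and \<open>n\<close> the kernel block.\<close>
    have "Q\<^sub>1 (B\<^sub>1 (X x)) = Q\<^sub>1 (T p) + Q\<^sub>1 n"
      using pn(1) by (simp add: pn(3) X T p2.kernel[OF pn(2)] blinfun.add_right blinfun.diff_right p1.Q_B_Q)
    then have "norm (Q\<^sub>1 (B\<^sub>1 (X x))) \<le> norm (Q\<^sub>1 (T p)) + norm (Q\<^sub>1 n)"
      by (simp add: norm_triangle_ineq)
    also have "\<dots> \<le> t * norm p + t * norm n"
      using p1.norm_Q_le[of "T p"] norm_blinfun[of T p] mult_right_mono[OF \<open>norm T \<le> t\<close> norm_ge_zero[of p]]
        kernel[OF pn(2)] by linarith
    finally have "norm (Q\<^sub>1 (B\<^sub>1 (X x))) \<le> t * (norm p + norm n)" by (simp add: distrib_left)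
    then have a: "(norm (Q\<^sub>1 (B\<^sub>1 (X x))))\<^sup>2 \<le> (t * (norm p + norm n))\<^sup>2" by (rule power_mono) simp
    \<comment> \<open>The component orthogonal to that final space comes from \<open>p\<close>
      alone: this is the vanishing block.\<close>
    have "X x - Q\<^sub>1 (B\<^sub>1 (X x)) = - (Q\<^sub>2 p - Q\<^sub>1 (B\<^sub>1 (Q\<^sub>2 p)))"
      by (simp add: pn(3) X p2.kernel[OF pn(2)] blinfun.add_right blinfun.diff_right p1.Q_B_Q)
    then have "norm (X x - Q\<^sub>1 (B\<^sub>1 (X x))) = norm (Q\<^sub>2 p - Q\<^sub>1 (B\<^sub>1 (Q\<^sub>2 p)))"
      by (simp only: norm_minus_cancel)
    also have "\<dots> \<le> t * norm p"
      using range[OF p2.Q_in_range[of p]] by (simp add: p2.isometric pn(1))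
    finally have b: "(norm (X x - Q\<^sub>1 (B\<^sub>1 (X x))))\<^sup>2 \<le> (t * norm p)\<^sup>2" by (rule power_mono) simp
    \<comment> \<open>Used with the squares of \<open>norm p\<close> and \<open>norm n\<close> for
      \<open>a\<close> and \<open>b\<close>, and \<open>2 * norm p * norm n\<close> for
      \<open>c\<close>; the 4 becomes the factor 2 of \<open>2 * t\<close>.\<close>
    have "a + b + c + a \<le> 4 * (a + b)" if "c \<le> a + b" "0 \<le> a" "0 \<le> b" for a b c :: real
      using that by simp
    from this[OF sum_squares_bound zero_le_power2 zero_le_power2]
    have "(norm p + norm n)\<^sup>2 + (norm p)\<^sup>2 \<le> 4 * ((norm p)\<^sup>2 + (norm n)\<^sup>2)"
      unfolding power2_sum .
    then have "t\<^sup>2 * ((norm p + norm n)\<^sup>2 + (norm p)\<^sup>2) \<le> t\<^sup>2 * (4 * (norm x)\<^sup>2)"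
      unfolding pn(4) by (rule mult_left_mono) simp
    moreover have "(norm (X x))\<^sup>2 \<le> (t * (norm p + norm n))\<^sup>2 + (t * norm p)\<^sup>2"
      unfolding p1.norm_sq_split[of "X x"] by (rule add_mono[OF a b])
    moreover have "(t * (norm p + norm n))\<^sup>2 + (t * norm p)\<^sup>2
        = t\<^sup>2 * ((norm p + norm n)\<^sup>2 + (norm p)\<^sup>2)"
      by (simp only: power_mult_distrib distrib_left[of "t\<^sup>2"])
    moreover have "t\<^sup>2 * (4 * (norm x)\<^sup>2) = (2 * t * norm x)\<^sup>2"
      by (simp add: power_mult_distrib)
    ultimately have "(norm (X x))\<^sup>2 \<le> (2 * t * norm x)\<^sup>2" by simp
    then show "norm (X x) \<le> 2 * t * norm x"
      by (rule power2_le_imp_le) (use t in simp)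
  qed (use t in simp)
qed

text \<open>\<open>op_abs A\<close> and \<open>A\<close> have equal norms at each vector, hence the
  same kernel and alike closed ranges, so the range of \<open>op_abs A\<close> is the initial space
  of \<open>Q\<close>.\<close>

lemma polar_of_polar_decomposition:
  fixes A Q :: "'a::complex_hilbert \<Rightarrow>\<^sub>L 'b::complex_hilbert"
  assumes A: "clinear_op A" "A \<noteq> 0" "closed (range A)" and Q: "polar_decomposition A Q"
  shows "polar A Q (adj Q) (op_abs A) (sigma_op A)"
proof -
  let ?S = "op_abs A"
  have Q_lin: "clinear_op Q" and null: "null_space Q = null_space A"
    and iso: "\<And>x. x \<in> ocomp (null_space Q) \<Longrightarrow> norm (Q x) = norm x"
    and eq: "A = Q o\<^sub>L ?S"
    using Q by (auto simp: polar_decomposition_def partial_isometry_def)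
  have pos: "positive_op ?S" by (rule positive_op_abs[OF A(1)])
  have S_0: "?S x = 0 \<longleftrightarrow> A x = 0" for x
    by (metis norm_eq_zero norm_op_abs_apply[OF A(1)])
  have null_S: "null_space ?S = null_space A" by (simp add: null_space_def S_0)
  have cl: "closed (range ?S)"
    by (rule closed_range_norm_eq[OF norm_op_abs_apply[OF A(1)] A(3)])
  have ne: "?S \<noteq> 0" using S_0 A(2) by (metis blinfun_eqI zero_blinfun.rep_eq)
  show ?thesis
  proof
    show "A x = Q (?S x)" for x
      by (subst eq) simp
    show "inner (?S x) y = inner x (?S y)" for x y by (rule positive_op_symmetric[OF pos])
    show "closed (range ?S)" by (rule cl)
    show "?S x = 0 \<Longrightarrow> Q x = 0" for x
      using null by (auto simp: S_0 null_space_def)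
    show "x \<in> range ?S \<Longrightarrow> norm (Q x) = norm x" for x
      by (rule iso) (simp add: null null_S range_eq_ocomp_null_space[OF pos cl])
    show "inner (Q x) y = inner x (adj Q y)" for x y by (rule adj_inner[OF Q_lin])
    show "0 < sigma_op A" "x \<in> range ?S \<Longrightarrow> sigma_op A * (norm x)\<^sup>2 \<le> inner x (?S x)" for x
      unfolding sigma_op_def by (rule Inf_spectrum_bounded_below[OF pos ne cl])+
  qed
qed

section \<open>Projections onto ranges and kernels, and gaps\<close>

lemma proj_eqI:
  assumes M: "subspace M" and y: "y \<in> M" "x - y \<in> ocomp M"
  shows "proj M x = y"
  unfolding proj_def
proof (rule the_equality)
  fix y' assume y': "y' \<in> M \<and> x - y' \<in> ocomp M"
  have z: "y - y' \<in> M" using y y' M by (simp add: subspace_diff)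
  have "cinner (y - y') (x - y) = 0" "cinner (y - y') (x - y') = 0"
    using z y y' by (auto simp: ocomp_def)
  then have "inner (y - y') (x - y) = 0" "inner (y - y') (x - y') = 0"
    by (simp_all flip: Re_cinner)
  then have "inner (y - y') (y - y') = 0"
    using inner_diff_right[of "y - y'" "x - y'" "x - y"] by simp
  then show "y' = y" by simp
qed (use y in auto)

lemma proj_range_polar:
  assumes A: "clinear_op A" and p: "polar A Q B S \<sigma>"
  shows "proj (range A) y = Q (B y)"
proof -
  interpret polar A Q B S \<sigma> by (rule p)
  show ?thesis
  proof (rule proj_eqI[OF subspace_range_blinfun Q_in_range])
    show "y - Q (B y) \<in> ocomp (range A)"
      unfolding ocomp_range_iff[OF A] by (simp add: A_eq inner_range_residual)
  qed
qed

lemma subspace_null_space: "subspace (null_space A)"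
  by (auto simp: subspace_def null_space_def blinfun.add_right blinfun.scaleR_right)

lemma null_space_polar:
  assumes p: "polar A Q B S \<sigma>"
  shows "x \<in> null_space A \<longleftrightarrow> S x = 0"
proof -
  interpret polar A Q B S \<sigma> by (rule p)
  show ?thesis
    using isometric[of "S x"] by (auto simp: null_space_def A_eq)
qed

text \<open>The residual is \<open>B (Q x)\<close>, whose norm is \<open>norm (Q x)\<close>, so gaps
  of kernels become bounds on polar factors.\<close>

lemma proj_null_space_polar:
  assumes A: "clinear_op A" and p: "polar A Q B S \<sigma>"
  shows "proj (null_space A) x = x - B (Q x)"
proof -
  interpret polar A Q B S \<sigma> by (rule p)
  obtain u n where un: "u \<in> range S" "S n = 0" "x = u + n" "Q x = Q u"
    using decomposition[of x] by metis
  have BQ: "B (Q x) = u" using un by (simp add: B_Q)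
  show ?thesis
  proof (rule proj_eqI[OF subspace_null_space])
    show "x - B (Q x) \<in> null_space A"
      unfolding null_space_polar[OF p] BQ by (simp add: un(2,3))
    have "A y = 0 \<Longrightarrow> inner y u = 0" for y
      using null_space_polar[OF p, of y] un(1) by (auto simp: null_space_def simp flip: symmetric)
    then show "x - (x - B (Q x)) \<in> ocomp (null_space A)"
      by (simp add: ocomp_null_space_iff[OF A] BQ)
  qed
qed

text \<open>Presenting the residual as a bounded operator \<open>F\<close> bounds the set under
  \<open>Sup\<close> and allows scaling to unit vectors.\<close>

lemma norm_le_gap:
  fixes F :: "'a::complex_hilbert \<Rightarrow>\<^sub>L 'a"
  assumes V: "subspace V" and F: "\<And>v. v \<in> V \<Longrightarrow> v - proj W v = F v" and v: "v \<in> V"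
  shows "norm (F v) \<le> gap V W * norm v"
proof (cases "v = 0")
  case False
  let ?N = "{norm (v - proj W v) |v. v \<in> V \<and> norm v = 1}"
  have "bdd_above ?N"
  proof (rule bdd_aboveI[of _ "norm F"])
    fix r assume "r \<in> ?N"
    then obtain u where "u \<in> V" "norm u = 1" "r = norm (F u)" using F by auto
    then show "r \<le> norm F" using norm_blinfun[of F u] by simp
  qed
  moreover have "norm (F ((1 / norm v) *\<^sub>R v)) \<in> ?N"
    using False F[symmetric] subspace_scale[OF V v] by (intro CollectI exI[of _ "(1 / norm v) *\<^sub>R v"]) simp
  ultimately have "norm (F ((1 / norm v) *\<^sub>R v)) \<le> Sup ?N" by (intro cSup_upper)
  moreover have "gap V W = Sup ?N" using False v by (auto simp: gap_def)
  ultimately show ?thesis using False by (simp add: blinfun.scaleR_right pos_divide_le_eq)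
qed simp

text \<open>\<open>0 \<le> t\<close> covers \<open>V = {0}\<close>, where \<open>gap\<close> is 0 by
  convention.\<close>

lemma gap_le:
  assumes V: "subspace V" and t: "0 \<le> t"
    and F: "\<And>v. v \<in> V \<Longrightarrow> norm (v - proj W v) \<le> t * norm v"
  shows "gap V W \<le> t"
proof (cases "V = {0}")
  case False
  then obtain v where v: "v \<in> V" "v \<noteq> 0" using subspace_0[OF V] by blast
  have "(1 / norm v) *\<^sub>R v \<in> V" "norm ((1 / norm v) *\<^sub>R v) = 1"
    using v by (auto intro: subspace_scale[OF V])
  then have "{norm (v - proj W v) |v. v \<in> V \<and> norm v = 1} \<noteq> {}" by blast
  then have "Sup {norm (v - proj W v) |v. v \<in> V \<and> norm v = 1} \<le> t"
    using F by (intro cSup_least) fastforce+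
  then show ?thesis using False by (simp add: gap_def)
qed (simp add: gap_def t)

lemma polar_factor_bound_ordered:
  fixes A\<^sub>1 A\<^sub>2 Q\<^sub>1 Q\<^sub>2 :: "'a::complex_hilbert \<Rightarrow>\<^sub>L 'b::complex_hilbert"
  assumes A: "clinear_op A\<^sub>1" "clinear_op A\<^sub>2"
    and P1: "polar A\<^sub>1 Q\<^sub>1 B\<^sub>1 S\<^sub>1 \<sigma>\<^sub>1" and P2: "polar A\<^sub>2 Q\<^sub>2 B\<^sub>2 S\<^sub>2 \<sigma>\<^sub>2" and \<sigma>: "\<sigma>\<^sub>2 \<le> \<sigma>\<^sub>1"
    and gap: "gap_diff (range A\<^sub>1) (range A\<^sub>2) = 0 \<or> gap_diff (null_space A\<^sub>1) (null_space A\<^sub>2) = 0"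
  shows "norm (Q\<^sub>1 - Q\<^sub>2) \<le> 4 / (\<sigma>\<^sub>1 + \<sigma>\<^sub>2) * norm (A\<^sub>1 - A\<^sub>2)"
proof -
  interpret p1: polar A\<^sub>1 Q\<^sub>1 B\<^sub>1 S\<^sub>1 \<sigma>\<^sub>1 by (rule P1)
  interpret p2: polar A\<^sub>2 Q\<^sub>2 B\<^sub>2 S\<^sub>2 \<sigma>\<^sub>2 by (rule P2)
  define t where "t = 2 / (\<sigma>\<^sub>1 + \<sigma>\<^sub>2) * norm (A\<^sub>1 - A\<^sub>2)"
  have pos: "0 < \<sigma>\<^sub>1" "0 < \<sigma>\<^sub>1 + \<sigma>\<^sub>2" using p1.sigma_pos p2.sigma_pos by auto
  have t: "0 \<le> t" using pos by (simp add: t_def)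
  have D: "2 * norm (A\<^sub>1 - A\<^sub>2) = t * (\<sigma>\<^sub>1 + \<sigma>\<^sub>2)" using pos by (simp add: t_def)
  \<comment> \<open>The ordering of the \<open>\<sigma>\<close>s gives
    \<open>norm (A\<^sub>1 - A\<^sub>2) \<le> t * \<sigma>\<^sub>1\<close>, which brings both cross
    estimates under \<open>t\<close>.\<close>
  have le_t: "r \<le> t * a" if "\<sigma>\<^sub>1 * r \<le> norm (A\<^sub>1 - A\<^sub>2) * a" "0 \<le> a" for r a
  proof -
    have "t * (\<sigma>\<^sub>1 + \<sigma>\<^sub>2) \<le> t * (2 * \<sigma>\<^sub>1)" using \<sigma> t by (intro mult_left_mono) auto
    then have "norm (A\<^sub>1 - A\<^sub>2) \<le> t * \<sigma>\<^sub>1" using D by linarith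
    then have "norm (A\<^sub>1 - A\<^sub>2) * a \<le> t * \<sigma>\<^sub>1 * a" using that(2) by (rule mult_right_mono)
    with that(1) have "\<sigma>\<^sub>1 * r \<le> \<sigma>\<^sub>1 * (t * a)" by (simp add: ac_simps)
    then show ?thesis using pos(1) by simp
  qed
  have kernel: "norm (Q\<^sub>1 n) \<le> t * norm n" if "n \<in> null_space A\<^sub>2" for n
    using that by (intro le_t polar_cross_kernel[OF P1]) (auto simp: null_space_def)
  have range: "norm (y - Q\<^sub>2 (B\<^sub>2 y)) \<le> t * norm y" if "y \<in> range A\<^sub>1" for y
    using that by (intro le_t polar_cross_range[OF P1 P2]) auto
  have "norm (Q\<^sub>1 - Q\<^sub>2) \<le> 2 * t"
    using gap
  proof
    \<comment> \<open>\<open>kernel\<close> already has the direction that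
      \<open>polar_distance\<close> needs for this order of indices; equality of the gaps reverses
      \<open>range\<close>.\<close>
    assume "gap_diff (range A\<^sub>1) (range A\<^sub>2) = 0"
    then have "gap (range A\<^sub>2) (range A\<^sub>1) = gap (range A\<^sub>1) (range A\<^sub>2)" by (simp add: gap_diff_def)
    also have "\<dots> \<le> t"
      by (rule gap_le[OF subspace_range_blinfun t]) (simp add: proj_range_polar[OF A(2) P2] range)
    finally have "gap (range A\<^sub>2) (range A\<^sub>1) \<le> t" .
    then have "norm (y - Q\<^sub>1 (B\<^sub>1 y)) \<le> t * norm y" if "y \<in> range A\<^sub>2" for y
      using norm_le_gap[OF subspace_range_blinfun[of A\<^sub>2] _ that, of "range A\<^sub>1" "id_blinfun - (Q\<^sub>1 o\<^sub>L B\<^sub>1)"]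
        mult_right_mono[OF _ norm_ge_zero[of y], of "gap (range A\<^sub>2) (range A\<^sub>1)" t]
      by (simp add: proj_range_polar[OF A(1) P1] blinfun.diff_left)
    moreover have "norm (Q\<^sub>1 n) \<le> t * norm n" if "S\<^sub>2 n = 0" for n
      using that by (intro kernel) (simp add: null_space_polar[OF P2])
    ultimately show ?thesis
      by (intro polar_distance[OF P1 P2 t]) (use D in auto)
  next
    \<comment> \<open>With the indices exchanged in \<open>polar_distance\<close> it is
      \<open>range\<close> that fits, and equality of the gaps reverses
      \<open>kernel\<close>.\<close>
    assume "gap_diff (null_space A\<^sub>1) (null_space A\<^sub>2) = 0"
    then have "gap (null_space A\<^sub>1) (null_space A\<^sub>2) = gap (null_space A\<^sub>2) (null_space A\<^sub>1)"
      by (simp add: gap_diff_def)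
    also have "\<dots> \<le> t"
      by (rule gap_le[OF subspace_null_space t])
        (simp add: proj_null_space_polar[OF A(1) P1] p1.norm_B_Q kernel)
    finally have gap_t: "gap (null_space A\<^sub>1) (null_space A\<^sub>2) \<le> t" .
    have "norm (Q\<^sub>2 n) \<le> t * norm n" if "S\<^sub>1 n = 0" for n
    proof -
      have "n \<in> null_space A\<^sub>1" using that by (simp add: null_space_polar[OF P1])
      from norm_le_gap[OF subspace_null_space _ this, of "null_space A\<^sub>2" "B\<^sub>2 o\<^sub>L Q\<^sub>2"]
      have "norm (Q\<^sub>2 n) \<le> gap (null_space A\<^sub>1) (null_space A\<^sub>2) * norm n"
        by (simp add: proj_null_space_polar[OF A(2) P2] p2.norm_B_Q)
      also have "\<dots> \<le> t * norm n" by (intro mult_right_mono gap_t) simp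
      finally show ?thesis .
    qed
    then have "norm (Q\<^sub>2 - Q\<^sub>1) \<le> 2 * t"
      by (intro polar_distance[OF P2 P1 t]) (use D range in \<open>auto simp: norm_minus_commute add.commute\<close>)
    then show ?thesis by (simp add: norm_minus_commute)
  qed
  then show ?thesis by (simp add: t_def)
qed

theorem theorem3p1:
  fixes A\<^sub>1 A\<^sub>2 Q\<^sub>1 Q\<^sub>2 :: "'a::complex_hilbert \<Rightarrow>\<^sub>L 'b::complex_hilbert"
  assumes "clinear_op A\<^sub>1" and "clinear_op A\<^sub>2"
    and "A\<^sub>1 \<noteq> 0" and "A\<^sub>2 \<noteq> 0"
    and "closed (range A\<^sub>1)" and "closed (range A\<^sub>2)"
    and "ind A\<^sub>1 = ind A\<^sub>2"
    and "gap_diff (range A\<^sub>1) (range A\<^sub>2) = 0 \<or> gap_diff (null_space A\<^sub>1) (null_space A\<^sub>2) = 0"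
    and "polar_decomposition A\<^sub>1 Q\<^sub>1" and "polar_decomposition A\<^sub>2 Q\<^sub>2"
  shows "norm (Q\<^sub>1 - Q\<^sub>2) \<le> 4 / (sigma_op A\<^sub>1 + sigma_op A\<^sub>2) * norm (A\<^sub>1 - A\<^sub>2)"
proof -
  note P1 = polar_of_polar_decomposition[OF assms(1,3,5,9)]
  note P2 = polar_of_polar_decomposition[OF assms(2,4,6,10)]
  show ?thesis
  proof (cases "sigma_op A\<^sub>2 \<le> sigma_op A\<^sub>1")
    case True
    show ?thesis by (rule polar_factor_bound_ordered[OF assms(1,2) P1 P2 True assms(8)])
  next
    \<comment> \<open>The claim is symmetric in the two indices, since \<open>gap_diff\<close>
      is.\<close>
    case False
    then have "sigma_op A\<^sub>1 \<le> sigma_op A\<^sub>2" by simp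
    from polar_factor_bound_ordered[OF assms(2,1) P2 P1 this] assms(8)
    show ?thesis by (simp add: gap_diff_def abs_minus_commute norm_minus_commute add.commute)
  qed
qed

end
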